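(* Let $R=\mathbb{Z}[d_1^{1/N_1},d_2^{1/N_2},\dots,d_r^{1/N_r}]$, where $d_1,d_2,\dots,d_r$ are pairwise relatively prime positive square-free integers with $d_j\ge 2$ for all $1\le j\le r$, and $N_i\ge 2$ is an integer for all $1\le i\le r$. Then, up to isomorphism, $R$ has exactly $$N_1^{m_1-1}N_2^{m_2-1}\cdots N_r^{m_r-1}$$ irreducible $\mathbb{Z}_+$-modules, where $m_j$ is the number of prime divisors of $d_j$.
   Context: $\mathbb{Z}_+$ denotes the set of non-negative integers. A unital $\mathbb{Z}_+$-ring is a unital domain $R$, free as a $\mathbb{Z}$-module with a fixed basis $\{x_1=1,x_2,\dots,x_n\}$ such that $x_ix_j=\sum_k c_{ij}^k x_k$ with all $c_{ij}^k\in\mathbb{Z}_+$. A $\mathbb{Z}_+$-module of $R$ is an $R$-module $M$ that is free over $\mathbb{Z}$ with a fixed finite nonempty basis $\{m_1,\dots,m_t\}$ (its $\mathbb{Z}_+$-basis; $t$ is the rank) such that $x_im_j=\sum_k a_{ij}^k m_k$ with all $a_{ij}^k\in\mathbb{Z}_+$. A $\mathbb{Z}_+$-submodule of $M$ is an $R$-submodule that is the $\mathbb{Z}$-span of a subset of $\{m_1,\dots,m_t\}$. $M$ is irreducible if it has no $\mathbb{Z}_+$-submodule other than $0$ and $M$. Two $\mathbb{Z}_+$-modules $M,M'$ of $R$ with bases $\{m_i\}_{i=1}^t$, $\{m'_i\}_{i=1}^t$ are isomorphic if there are an $R$-module homomorphism $\psi:M\to M'$ and a permutation $\sigma\in S_t$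 with $\psi(m_i)=m'_{\sigma(i)}$ for all $i$. All roots $d_j^{1/N_j}$ are positive real roots. $R=\mathbb{Z}[d_1^{1/N_1},\dots,d_r^{1/N_r}]\subset\mathbb{R}$ is a $\mathbb{Z}_+$-ring with $\mathbb{Z}_+$-basis the products $d_1^{i_1/N_1}d_2^{i_2/N_2}\cdots d_r^{i_r/N_r}$, $0\le i_s\le N_s-1$ for $1\le s\le r$. *)

theory Defs
  imports
    Complex_Main
    "HOL-Algebra.Algebra"
    "HOL-Algebra.Algebraic_Closure_Type"
    "HOL-Computational_Algebra.Computational_Algebra"
begin

section \<open>Finitely generated free \<open>\<int>\<close>-modules\<close>

text \<open>Only the additive structure of \<open>G\<close> is used below, so that \<open>G\<close> can be either a ring or
  a module record.\<close>

definition int_comb :: "('a, 'z) ring_scheme \<Rightarrow> 'a set \<Rightarrow> ('a \<Rightarrow> int) \<Rightarrow> 'a"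
  where "int_comb G B c = (\<Oplus>\<^bsub>G\<^esub>b\<in>B. [c b] \<cdot>\<^bsub>G\<^esub> b)"

definition int_span :: "('a, 'z) ring_scheme \<Rightarrow> 'a set \<Rightarrow> 'a set"
  where "int_span G B = range (int_comb G B)"

definition int_basis :: "('a, 'z) ring_scheme \<Rightarrow> 'a set \<Rightarrow> bool"
  where "int_basis G B \<longleftrightarrow>
    finite B \<and> B \<subseteq> carrier G \<and> int_span G B = carrier G \<and>
    (\<forall>c. int_comb G B c = \<zero>\<^bsub>G\<^esub> \<longrightarrow> (\<forall>b\<in>B. c b = 0))"

definition nonneg_span :: "('a, 'z) ring_scheme \<Rightarrow> 'a set \<Rightarrow> 'a set"
  where "nonneg_span G B = {int_comb G B c | c. \<forall>b\<in>B. 0 \<le> c b}"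

section \<open>\<open>\<int>\<^sub>+\<close>-rings and \<open>\<int>\<^sub>+\<close>-modules\<close>

text \<open>The fixed bases are part of the data and are given as finite sets. The locale \<^locale>\<open>domain\<close>
  makes the \<open>\<int>\<^sub>+\<close>-rings considered here commutative.\<close>

locale zplus_ring = domain R for R (structure) and A +
  assumes ring_basis: "int_basis R A"
    and one_in_basis: "\<one> \<in> A"
    and basis_mult: "\<lbrakk>x \<in> A; y \<in> A\<rbrakk> \<Longrightarrow> x \<otimes> y \<in> nonneg_span R A"

locale zplus_module = zplus_ring R A + module R M
  for R (structure) and A and M (structure) and B +
  assumes module_basis: "int_basis M B"
    and basis_nonempty: "B \<noteq> {}"
    and basis_smult: "\<lbrakk>x \<in> A; m \<in> B\<rbrakk> \<Longrightarrow> x \<odot>\<^bsub>M\<^esub> m \<in> nonneg_span M B"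

definition zplus_submodule ::
    "'m set \<Rightarrow> ('r, 'z) ring_scheme \<Rightarrow> ('r, 'm) module \<Rightarrow> 'm set \<Rightarrow> bool"
  where "zplus_submodule H R M B \<longleftrightarrow> submodule H R M \<and> (\<exists>S\<subseteq>B. H = int_span M S)"

definition irreducible_zplus_module ::
    "('r, 'z) ring_scheme \<Rightarrow> 'r set \<Rightarrow> ('r, 'm) module \<Rightarrow> 'm set \<Rightarrow> bool"
  where "irreducible_zplus_module R A M B \<longleftrightarrow>
    zplus_module R A M B \<and>
    (\<forall>H. zplus_submodule H R M B \<longrightarrow> H = {\<zero>\<^bsub>M\<^esub>} \<or> H = carrier M)"

definition module_homs ::
    "('r, 'z) ring_scheme \<Rightarrow> ('r, 'm) module \<Rightarrow> ('r, 'n) module \<Rightarrow> ('m \<Rightarrow> 'n) set"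
  where "module_homs R M M' =
    {h \<in> carrier M \<rightarrow> carrier M'.
      (\<forall>x\<in>carrier M. \<forall>y\<in>carrier M. h (x \<oplus>\<^bsub>M\<^esub> y) = h x \<oplus>\<^bsub>M'\<^esub> h y) \<and>
      (\<forall>a\<in>carrier R. \<forall>x\<in>carrier M. h (a \<odot>\<^bsub>M\<^esub> x) = a \<odot>\<^bsub>M'\<^esub> h x)}"

text \<open>For bases \<open>m\<^sub>1, \<dots>, m\<^sub>t\<close> and \<open>m'\<^sub>1, \<dots>, m'\<^sub>t\<close>, a map \<open>\<psi>\<close> satisfies
  \<open>\<psi> (m\<^sub>i) = m'\<^bsub>\<sigma>(i)\<^esub>\<close> for some permutation \<open>\<sigma>\<close> of the indices
  iff it restricts to a bijection between the two basis sets.\<close>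

definition zplus_isomorphic ::
    "('r, 'z) ring_scheme \<Rightarrow> ('r, 'm) module \<Rightarrow> 'm set \<Rightarrow> ('r, 'n) module \<Rightarrow> 'n set \<Rightarrow> bool"
  where "zplus_isomorphic R M B M' B' \<longleftrightarrow> (\<exists>\<psi>\<in>module_homs R M M'. bij_betw \<psi> B B')"

section \<open>The ring \<open>\<int>[d\<^sub>1\<^bsup>1/N\<^sub>1\<^esup>, \<dots>, d\<^sub>r\<^bsup>1/N\<^sub>r\<^esup>]\<close>\<close>

text \<open>\<^const>\<open>ring_of_type_algebra\<close> is here the field of real numbers, viewed as a ring record.\<close>

definition root_ring :: "nat \<Rightarrow> (nat \<Rightarrow> nat) \<Rightarrow> (nat \<Rightarrow> nat) \<Rightarrow> real ring"
  where "root_ring r d N = ring_of_type_algebra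
    \<lparr>carrier := generate_ring ring_of_type_algebra ((\<lambda>j. root (N j) (real (d j))) ` {1..r})\<rparr>"

definition root_basis :: "nat \<Rightarrow> (nat \<Rightarrow> nat) \<Rightarrow> (nat \<Rightarrow> nat) \<Rightarrow> real set"
  where "root_basis r d N =
    {\<Prod>s=1..r. root (N s) (real (d s)) ^ i s | i. \<forall>s\<in>{1..r}. i s \<le> N s - 1}"

end

theory Submission
  imports Defs
begin

text \<open>Write \<open>v\<^sub>i\<close> for the product of the \<open>d\<^sub>s\<^bsup>i\<^sub>s/N\<^sub>s\<^esup>\<close>, where the exponent vector \<open>i\<close> is read modulo
  \<open>(N\<^sub>1, \<dots>, N\<^sub>r)\<close>. Then \<open>v\<^sub>i v\<^sub>j = c(i,j) v\<^bsub>i+j\<^esub>\<close>, where \<open>c(i,j)\<close> is the product of those \<open>d\<^sub>s\<close> at which the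
  addition \<open>i\<^sub>s + j\<^sub>s\<close> overflows. The whole classification rests on three facts.

  The \<open>v\<^sub>i\<close> are linearly independent over \<open>\<rat>\<close> (\<open>radicals_independent\<close>), so they are indeed a
  \<open>\<int>\<^sub>+\<close>-basis. Pairwise quotients of them are irrational because the \<open>d\<^sub>s\<close> are square-free and coprime.
  A positive real \<open>a\<close> with a rational power, say \<open>a\<^sup>k\<close> with \<open>k\<close> least, has minimal polynomial \<open>X\<^sup>k - a\<^sup>k\<close>,
  because all roots of a rational factor have absolute value \<open>a\<close> and its constant term is rational. If \<open>a\<close> is
  irrational, multiplication by \<open>a\<close> therefore has trace \<open>0\<close> on every finite-dimensional rational space
  that it preserves. Dividing a linear relation by one of its radicals and taking traces shows that
  the coefficient of that radical vanishes.

  On any \<open>\<int>\<^sub>+\<close>-module, \<open>v\<^sub>i\<close> acts on the basis by a monomial matrix (\<open>monomial_action\<close>), as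
  \<open>v\<^sub>i v\<^bsub>-i\<^esub>\<close> is a positive integer and both factors act by nonnegative matrices. So the exponent vectors permute the
  basis. In an irreducible module this action is transitive, since orbits span submodules
  (\<open>irreducible_imp_transitive\<close>), and free, since a coincidence would make a quotient \<open>v\<^sub>i / v\<^sub>j\<close>
  rational (\<open>shift_inj\<close>). Fixing a base point \<open>b\<close> and writing \<open>v\<^sub>i b = w\<^sub>i b\<^sub>i\<close> with basis elements \<open>b\<^sub>i\<close>
  identifies the module with the lattice in \<open>\<real>\<close> that has basis \<open>v\<^sub>i / w\<^sub>i\<close>
  (\<open>isomorphic_to_lattice_module\<close>), where \<open>w\<^sub>0 = 1\<close> and \<open>w\<^sub>j\<close> divides \<open>c(i,j) w\<^bsub>i+j\<^esub>\<close>.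

  This divisibility pins \<open>w\<close> down (\<open>cocycle_thresholds\<close>): \<open>w\<^sub>i\<close> is square-free, and for each prime \<open>p\<close> dividing
  \<open>d\<^sub>s\<close> there is a threshold \<open>t\<^sub>p\<close> in \<open>{1, \<dots>, N\<^sub>s}\<close> with \<open>p\<close> dividing \<open>w\<^sub>i\<close> exactly when
  \<open>t\<^sub>p \<le> i\<^sub>s\<close>. Conversely, thresholds can be prescribed at will
  (\<open>cocycle_weight\<close> does this with \<open>N\<^sub>s\<close> for one chosen prime of each \<open>d\<^sub>s\<close>). Moving the base point along the
  \<open>s\<close>-th direction shifts all thresholds of the primes dividing \<open>d\<^sub>s\<close> cyclically, so there is exactly one base point for
  which each chosen prime has threshold \<open>N\<^sub>s\<close>
  (\<open>exists_normalizing_shift\<close>, \<open>weight_modules_isomorphic_imp_eq\<close>). The thresholds of the remaining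
  \<open>m\<^sub>s - 1\<close> primes of each \<open>d\<^sub>s\<close> are free, which gives the stated number.\<close>

section \<open>Rational polynomials at a real radical\<close>

text \<open>Up to sign, the constant coefficient is the leading coefficient times the product of the roots.\<close>

lemma norm_constant_coeff_of_roots:
  fixes p :: "complex poly"
  assumes "p \<noteq> 0" and "\<And>z. poly p z = 0 \<Longrightarrow> norm z = a"
  shows "norm (Polynomial.coeff p 0) = norm (Polynomial.lead_coeff p) * a ^ Polynomial.degree p"
  using assms
proof (induction "Polynomial.degree p" arbitrary: p)
  case 0
  then obtain c where "p = [:c:]" by (metis degree_eq_zeroE)
  then show ?case by simp
next
  case (Suc n)
  then obtain z where z: "poly p z = 0"
    by (metis constant_degree fundamental_theorem_of_algebra nat.distinct(1))
  then obtain q where q: "p = [:- z, 1:] * q"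
    by (metis dvdE poly_eq_0_iff_dvd)
  with Suc.prems have "q \<noteq> 0" by auto
  then have deg: "Polynomial.degree p = Suc (Polynomial.degree q)"
    unfolding q by (subst degree_mult_eq) auto
  have IH: "norm (Polynomial.coeff q 0) = norm (Polynomial.lead_coeff q) * a ^ Polynomial.degree q"
    using Suc.hyps deg \<open>q \<noteq> 0\<close> Suc.prems(2) by (auto simp: q)
  have "Polynomial.lead_coeff p = Polynomial.lead_coeff q"
    unfolding q lead_coeff_mult by simp
  moreover have "norm (Polynomial.coeff p 0) = a * norm (Polynomial.coeff q 0)"
    using Suc.prems(2)[OF z] by (simp add: q norm_mult)
  ultimately show ?case using IH deg by simp
qed

lemma poly_of_rat_add:
  "poly (map_poly (of_rat :: rat \<Rightarrow> 'a::field_char_0) (p + q)) x =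
    poly (map_poly of_rat p) x + poly (map_poly of_rat q) x"
proof -
  have "map_poly (of_rat :: rat \<Rightarrow> 'a) (p + q) = map_poly of_rat p + map_poly of_rat q"
    by (rule poly_eqI) (simp add: coeff_map_poly of_rat_add)
  then show ?thesis by simp
qed

lemma poly_of_rat_mult:
  "poly (map_poly (of_rat :: rat \<Rightarrow> 'a::field_char_0) (p * q)) x =
    poly (map_poly of_rat p) x * poly (map_poly of_rat q) x"
proof -
  have "map_poly (of_rat :: rat \<Rightarrow> 'a) (p * q) = map_poly of_rat p * map_poly of_rat q"
    by (rule poly_eqI) (simp add: coeff_map_poly coeff_mult of_rat_sum of_rat_mult)
  then show ?thesis by simp
qed

lemma poly_of_rat_binomial:
  "poly (map_poly (of_rat :: rat \<Rightarrow> 'a::field_char_0) (Polynomial.monom 1 k - [:c:])) x = x ^ k - of_rat c"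
proof -
  have "map_poly (of_rat :: rat \<Rightarrow> 'a) (Polynomial.monom 1 k - [:c:]) = Polynomial.monom 1 k - [:of_rat c:]"
    by (rule poly_eqI) (simp add: coeff_map_poly of_rat_diff coeff_pCons split: nat.split)
  then show ?thesis by (simp add: poly_monom)
qed

lemma of_real_of_rat: "complex_of_real (of_rat c) = of_rat c"
  by (cases c) (simp add: of_rat_rat)

lemma norm_of_rat: "norm (of_rat c :: complex) = of_rat \<bar>c\<bar>"
  by (simp add: of_real_of_rat[symmetric] abs_if of_rat_minus)

text \<open>This contains the irreducibility of \<open>X\<^sup>k - a\<^sup>k\<close> over \<open>\<rat>\<close>: a common factor of \<open>p\<close> and
  \<open>X\<^sup>k - a\<^sup>k\<close> has only roots of absolute value \<open>a\<close>, so its degree is an exponent for which the power of \<open>a\<close> is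
  rational. By minimality of \<open>k\<close> the factor is constant, and Bezout's identity yields \<open>u\<close>.\<close>

lemma rat_poly_value_invertible:
  fixes a :: real and p :: "rat poly"
  assumes a: "a > 0" and k: "k > 0" "a ^ k = of_rat c"
    and least: "\<And>j. 0 < j \<Longrightarrow> j < k \<Longrightarrow> a ^ j \<notin> \<rat>"
    and p: "p \<noteq> 0" "Polynomial.degree p < k"
  shows "\<exists>u. poly (map_poly of_rat u) a * poly (map_poly of_rat p) a = 1"
proof -
  define m where "m = Polynomial.monom 1 k - [:c:]"
  \<comment> \<open>It suffices that \<open>f\<close> is constant.\<close>
  define f where "f = gcd p m"
  have f0: "f \<noteq> 0" and fp: "f dvd p" and fm: "f dvd m" using p by (auto simp: f_def)
  have df: "Polynomial.degree f < k" using p dvd_imp_degree_le[OF fp] by simp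
  define F where "F = map_poly (of_rat :: rat \<Rightarrow> complex) f"
  have degF: "Polynomial.degree F = Polynomial.degree f" unfolding F_def by (rule degree_map_poly) simp
  have coeffF: "Polynomial.coeff F i = of_rat (Polynomial.coeff f i)" for i
    by (simp add: F_def coeff_map_poly)
  have F0: "F \<noteq> 0" using f0 coeffF[of "Polynomial.degree f"] by auto
  have roots: "norm z = a" if z: "poly F z = 0" for z
  proof -
    obtain g where "m = f * g" using fm by blast
    then have "z ^ k - of_rat c = (0::complex)"
      using z poly_of_rat_binomial[of k c z] by (simp add: m_def poly_of_rat_mult F_def)
    then have "z ^ k = of_real (a ^ k)" using k by (simp add: of_real_of_rat)
    then have "norm z ^ k = a ^ k" using a
      by (metis norm_of_real norm_power abs_of_pos zero_less_power)
    then show ?thesis using a k by (metis less_imp_le norm_ge_zero power_eq_imp_eq_base)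
  qed
  have "norm (Polynomial.coeff F 0) = norm (Polynomial.lead_coeff F) * a ^ Polynomial.degree f"
    using norm_constant_coeff_of_roots[OF F0 roots] degF by simp
  then have "a ^ Polynomial.degree f = of_rat \<bar>Polynomial.coeff f 0 / Polynomial.lead_coeff f\<bar>"
    using f0 by (simp add: coeffF degF norm_of_rat of_rat_divide abs_divide field_simps)
  then have "a ^ Polynomial.degree f \<in> \<rat>" by simp
  with least df have "Polynomial.degree f = 0" by blast
  then obtain e where e: "f = [:e:]" "e \<noteq> 0" using f0 by (metis degree_eq_zeroE pCons_0_0)
  obtain u v where "u * p + v * m = f" using bezout_coefficients_fst_snd unfolding f_def by blast
  then have "poly (map_poly of_rat (u * p + v * m)) a = of_rat e"
    using e by (simp add: map_poly_pCons)
  then have "poly (map_poly of_rat u) a * poly (map_poly of_rat p) a = of_rat e"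
    using k by (simp add: poly_of_rat_add poly_of_rat_mult m_def poly_of_rat_binomial)
  then have "poly (map_poly of_rat (smult (inverse e) u)) a * poly (map_poly of_rat p) a = 1"
    using e by (simp add: map_poly_smult of_rat_mult of_rat_inverse mult.assoc)
  then show ?thesis by blast
qed

section \<open>Traces over the rationals and independence of radicals\<close>

interpretation rat_real: vector_space "\<lambda>(q::rat) (x::real). of_rat q * x"
  by unfold_locales (auto simp: algebra_simps of_rat_add of_rat_mult)

text \<open>The trace of multiplication by \<open>x\<close> on the rational span of \<open>B\<close>; it is meaningful when \<open>B\<close> is
  independent and its span is stable under this multiplication.\<close>

definition rat_trace :: "real set \<Rightarrow> real \<Rightarrow> rat" where
  "rat_trace B x = (\<Sum>b\<in>B. rat_real.representation B (x * b) b)"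

text \<open>The usual argument that the trace of \<open>UV\<close> equals that of \<open>VU\<close>, applied to the two base change matrices.\<close>

lemma rat_trace_basis_change:
  assumes B: "finite B" "rat_real.independent B" and C: "finite C" "rat_real.independent C"
    and BC: "rat_real.span B = rat_real.span C"
    and x: "\<And>v. v \<in> rat_real.span B \<Longrightarrow> x * v \<in> rat_real.span B"
  shows "rat_trace B x = rat_trace C x"
proof -
  let ?rB = "rat_real.representation B" and ?rC = "rat_real.representation C"
  have memB: "c \<in> rat_real.span B" if "c \<in> C" for c using that BC rat_real.span_base by blast
  have xb: "x * b \<in> rat_real.span C" if "b \<in> B" for b using x that BC rat_real.span_base by blast
  have "?rB (x * b) b = (\<Sum>c\<in>C. ?rC (x * b) c * ?rB c b)" if b: "b \<in> B" for b
  proof -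
    have "?rB (\<Sum>c\<in>C. of_rat (?rC (x * b) c) * c) b = (\<Sum>c\<in>C. ?rC (x * b) c * ?rB c b)"
      using memB by (subst rat_real.representation_sum)
        (auto intro!: B rat_real.span_scale simp: rat_real.representation_scale[OF B(2)])
    then show ?thesis
      using rat_real.sum_representation_eq[OF C(2) xb[OF b] C(1)] by simp
  qed
  then have "rat_trace B x = (\<Sum>b\<in>B. \<Sum>c\<in>C. ?rC (x * b) c * ?rB c b)"
    by (simp add: rat_trace_def)
  also have "\<dots> = (\<Sum>c\<in>C. \<Sum>b\<in>B. ?rB c b * ?rC (x * b) c)"
    by (subst sum.swap) (simp add: mult.commute)
  also have "\<dots> = rat_trace C x"
    unfolding rat_trace_def
  proof (rule sum.cong[OF refl])
    fix c assume c: "c \<in> C"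
    have "x * c = (\<Sum>b\<in>B. of_rat (?rB c b) * (x * b))"
      using rat_real.sum_representation_eq[OF B(2) memB[OF c] B(1)]
      by (simp add: sum_distrib_left[symmetric] mult.left_commute)
    also have "?rC \<dots> c = (\<Sum>b\<in>B. ?rB c b * ?rC (x * b) c)"
      using xb by (subst rat_real.representation_sum)
        (auto intro!: C rat_real.span_scale simp: rat_real.representation_scale[OF C(2)])
    finally show "(\<Sum>b\<in>B. ?rB c b * ?rC (x * b) c) = ?rC (x * c) c" by simp
  qed
  finally show ?thesis .
qed

text \<open>Here \<open>k\<close> is the order of \<open>a\<close> modulo the rationals, hence the degree of the field \<open>\<rat>(a)\<close>.\<close>

locale rational_radical =
  fixes a :: real and k :: nat and c :: rat
  assumes pos: "a > 0" and k_pos: "k > 0" and power_k: "a ^ k = of_rat c"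
    and minimal: "\<And>j. 0 < j \<Longrightarrow> j < k \<Longrightarrow> a ^ j \<notin> \<rat>"
begin

abbreviation ev :: "rat poly \<Rightarrow> real" where
  "ev p \<equiv> poly (map_poly of_rat p) a"

lemma ev_reduce: "\<exists>q. ev q = ev p \<and> (\<forall>n\<ge>k. Polynomial.coeff q n = 0)"
proof -
  define m where "m = Polynomial.monom 1 k - [:c:]"
  have deg: "Polynomial.degree m = k"
    unfolding m_def using k_pos by (simp add: diff_conv_add_uminus degree_add_eq_left degree_monom_eq)
  have "ev p = ev (m * (p div m) + p mod m)" by simp
  also have "\<dots> = ev (p mod m)"
    using power_k unfolding poly_of_rat_add poly_of_rat_mult m_def by (simp add: poly_of_rat_binomial)
  finally have "ev (p mod m) = ev p" by simp
  moreover have "Polynomial.coeff (p mod m) n = 0" if "n \<ge> k" for n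
    using degree_mod_less[of m p] deg k_pos that coeff_eq_0[of "p mod m" n] by fastforce
  ultimately show ?thesis by blast
qed

lemma ev_eq_sum:
  assumes "\<forall>n\<ge>k. Polynomial.coeff q n = 0"
  shows "ev q = (\<Sum>j<k. of_rat (Polynomial.coeff q j) * a ^ j)"
proof -
  have "Polynomial.degree (map_poly (of_rat :: rat \<Rightarrow> real) q) < k"
    using assms k_pos by (intro le_less_trans[OF degree_le[of "k - 1"]]) (auto simp: coeff_map_poly)
  then have "(\<Sum>j<k. Polynomial.coeff (map_poly of_rat q) j * a ^ j) = ev q"
    unfolding poly_altdef by (intro sum.mono_neutral_right) (auto simp: coeff_eq_0)
  then show ?thesis by (simp add: coeff_map_poly)
qed

lemma ev_invertible:
  assumes "ev p \<noteq> 0"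
  shows "\<exists>u. ev u * ev p = 1"
proof -
  obtain q where q: "ev q = ev p" "\<forall>n\<ge>k. Polynomial.coeff q n = 0" using ev_reduce by blast
  then have "q \<noteq> 0" using assms by auto
  then have "Polynomial.degree q < k"
    using q(2) by (meson leading_coeff_0_iff not_le)
  then show ?thesis
    using rat_poly_value_invertible[OF pos k_pos power_k minimal \<open>q \<noteq> 0\<close>] q(1) by simp
qed

lemma powers_independent:
  assumes "(\<Sum>j<k. of_rat (q j) * a ^ j) = 0" "j < k"
  shows "q j = 0"
proof -
  define p where "p = (\<Sum>j<k. Polynomial.monom (q j) j)"
  have co: "Polynomial.coeff p n = (if n < k then q n else 0)" for n
    unfolding p_def by (simp add: coeff_sum)
  have "ev p = 0" using assms(1) by (subst ev_eq_sum) (auto simp: co)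
  have "p = 0"
  proof (rule ccontr)
    assume "p \<noteq> 0"
    moreover from this have "Polynomial.degree p < k"
      using co by (metis leading_coeff_0_iff)
    ultimately show False
      using rat_poly_value_invertible[OF pos k_pos power_k minimal] \<open>ev p = 0\<close> by fastforce
  qed
  then show ?thesis using co[of j] assms(2) by simp
qed

text \<open>Linear independence over the field \<open>\<rat>(a)\<close>, whose elements are the values \<open>ev p\<close> of rational polynomials
  at \<open>a\<close>.\<close>

definition indep_over_field :: "real set \<Rightarrow> bool" where
  "indep_over_field T \<longleftrightarrow> finite T \<and>
    (\<forall>p. (\<Sum>t\<in>T. ev (p t) * t) = 0 \<longrightarrow> (\<forall>t\<in>T. ev (p t) = 0))"

lemma member_eq_combination:
  assumes "finite T" "v \<in> T"
  shows "\<exists>p. v = (\<Sum>t\<in>T. ev (p t) * t)"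
proof
  have "(\<Sum>t\<in>T. ev (if t = v then 1 else 0) * t) = (\<Sum>t\<in>T. if t = v then v else 0)"
    by (rule sum.cong) auto
  also have "\<dots> = v" using assms by simp
  finally show "v = (\<Sum>t\<in>T. ev ((\<lambda>t. if t = v then 1 else 0) t) * t)" by simp
qed

lemma indep_over_field_insert:
  assumes T: "indep_over_field T" and v: "\<And>p. v \<noteq> (\<Sum>t\<in>T. ev (p t) * t)"
  shows "indep_over_field (insert v T)"
proof -
  have fin: "finite T" using T by (simp add: indep_over_field_def)
  have "v \<notin> T" using v member_eq_combination[OF fin, of v] by blast
  have "\<forall>t\<in>insert v T. ev (p t) = 0" if s: "(\<Sum>t\<in>insert v T. ev (p t) * t) = 0" for p
  proof -
    have s': "ev (p v) * v + (\<Sum>t\<in>T. ev (p t) * t) = 0" using s fin \<open>v \<notin> T\<close> by simp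
    have "ev (p v) = 0"
    proof (rule ccontr)
      assume "ev (p v) \<noteq> 0"
      then obtain u where u: "ev u * ev (p v) = 1" using ev_invertible by blast
      have "ev u * (ev (p v) * v + (\<Sum>t\<in>T. ev (p t) * t)) = v + (\<Sum>t\<in>T. ev u * (ev (p t) * t))"
        using u by (simp add: distrib_left mult.assoc[symmetric] sum_distrib_left)
      then have "v = - (\<Sum>t\<in>T. ev u * (ev (p t) * t))" using s' by simp
      also have "\<dots> = (\<Sum>t\<in>T. ev ([:-1:] * u * p t) * t)"
        unfolding poly_of_rat_mult by (simp add: sum_negf mult.assoc map_poly_pCons)
      finally show False using v[of "\<lambda>t. [:-1:] * u * p t"] by contradiction
    qed
    then show ?thesis using s' T by (auto simp: indep_over_field_def)
  qed
  then show ?thesis using fin by (simp add: indep_over_field_def)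
qed

lemma indep_over_field_imp_independent:
  assumes "indep_over_field T"
  shows "rat_real.independent T"
proof (rule rat_real.independent_if_scalars_zero)
  fix f x assume "(\<Sum>t\<in>T. of_rat (f t) * t) = 0" "x \<in> T"
  then have "ev [:f x:] = 0"
    using assms unfolding indep_over_field_def
    by (elim conjE allE[of _ "\<lambda>t. [:f t:]"]) (simp add: map_poly_pCons)
  then show "f x = 0" by (simp add: map_poly_pCons)
qed (use assms in \<open>simp add: indep_over_field_def\<close>)

lemma ev_stable:
  assumes "rat_real.subspace V" "\<And>v. v \<in> V \<Longrightarrow> a * v \<in> V" "v \<in> V"
  shows "ev p * v \<in> V"
proof (induction p)
  case (pCons q p)
  have "ev (pCons q p) * v = of_rat q * v + a * (ev p * v)"
    by (simp add: map_poly_pCons algebra_simps)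
  then show ?case using pCons assms by (auto intro: rat_real.subspace_add rat_real.subspace_scale)
qed (use assms in \<open>simp add: rat_real.subspace_0\<close>)

text \<open>A rational space that is stable under multiplication by \<open>a\<close> is a vector space over \<open>\<rat>(a)\<close>; a
  largest independent set is a basis, and sizes are bounded by the dimension over \<open>\<rat>\<close>.\<close>

lemma exists_field_basis:
  assumes B: "finite B" and V: "V = rat_real.span B"
    and stable: "\<And>v. v \<in> V \<Longrightarrow> a * v \<in> V"
  obtains T where "indep_over_field T" "T \<subseteq> V" "V = {\<Sum>t\<in>T. ev (p t) * t | p. True}"
proof -
  let ?P = "\<lambda>T. indep_over_field T \<and> T \<subseteq> V"
  have "?P {}" by (simp add: indep_over_field_def)
  moreover have "\<forall>T. ?P T \<longrightarrow> card T < Suc (card B)"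
    unfolding less_Suc_eq_le using rat_real.independent_span_bound[OF B indep_over_field_imp_independent] V by blast
  ultimately have "\<exists>T. ?P T \<and> (\<forall>S. ?P S \<longrightarrow> card S \<le> card T)"
    by (rule ex_has_greatest_nat)
  then obtain T where T: "?P T" and max: "\<And>S. ?P S \<Longrightarrow> card S \<le> card T" by blast
  have finT: "finite T" using T by (simp add: indep_over_field_def)
  have sub: "rat_real.subspace V" unfolding V by (rule rat_real.subspace_span)
  have "v \<in> {\<Sum>t\<in>T. ev (p t) * t | p. True}" if v: "v \<in> V" for v
  proof (rule ccontr)
    assume n: "v \<notin> {\<Sum>t\<in>T. ev (p t) * t | p. True}"
    then have "indep_over_field (insert v T)" using T by (intro indep_over_field_insert) auto
    moreover have "v \<notin> T"
    proof
      assume "v \<in> T"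
      then obtain p where "v = (\<Sum>t\<in>T. ev (p t) * t)"
        using member_eq_combination[OF finT] by blast
      then show False using n by blast
    qed
    ultimately show False using max[of "insert v T"] T v finT by simp
  qed
  moreover have "(\<Sum>t\<in>T. ev (p t) * t) \<in> V" for p
    using T by (intro rat_real.subspace_sum[OF sub] ev_stable[OF sub stable]) auto
  ultimately have "V = {\<Sum>t\<in>T. ev (p t) * t | p. True}"
    by (intro equalityI subsetI) auto
  with T show ?thesis by (intro that) auto
qed

text \<open>If \<open>T\<close> is a basis over \<open>\<rat>(a)\<close>, then the products \<open>a\<^sup>j t\<close> with \<open>j < k\<close> and \<open>t \<in> T\<close> form a basis
  over \<open>\<rat>\<close>. Multiplication by \<open>a\<close> sends each of them to a rational multiple of a different one, so
  its matrix has zero diagonal.\<close>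

lemma trace_eq_0:
  assumes B: "finite B" "rat_real.independent B"
    and stable: "\<And>v. v \<in> rat_real.span B \<Longrightarrow> a * v \<in> rat_real.span B"
    and k: "k \<ge> 2"
  shows "rat_trace B a = 0"
proof -
  define V where "V = rat_real.span B"
  have sub: "rat_real.subspace V" unfolding V_def by (rule rat_real.subspace_span)
  obtain T where T: "indep_over_field T" "T \<subseteq> V" and VT: "V = {\<Sum>t\<in>T. ev (p t) * t | p. True}"
    using exists_field_basis[OF B(1) V_def] stable V_def by blast
  have finT: "finite T" using T by (simp add: indep_over_field_def)
  define e where "e = (\<lambda>(t, j). a ^ j * t)"
  define C where "C = e ` (T \<times> {..<k})"
  have zero: "q (t, j) = 0"
    if "(\<Sum>x\<in>T\<times>{..<k}. of_rat (q x) * e x) = 0" "t \<in> T" "j < k" for q t j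
  proof -
    define p where "p t = (\<Sum>j<k. Polynomial.monom (q (t, j)) j)" for t
    have co: "Polynomial.coeff (p t) n = (if n < k then q (t, n) else 0)" for t n
      unfolding p_def by (simp add: coeff_sum)
    have ev: "ev (p t) = (\<Sum>j<k. of_rat (q (t, j)) * a ^ j)" for t
      by (subst ev_eq_sum) (auto simp: co)
    have "(\<Sum>t\<in>T. ev (p t) * t) = 0"
      using that(1) by (simp add: ev e_def sum.cartesian_product sum_distrib_right mult.assoc
          split_def)
    then have "ev (p t) = 0" using T(1) that(2) by (auto simp: indep_over_field_def)
    then show ?thesis using powers_independent[of "\<lambda>j. q (t, j)"] ev that(3) by simp
  qed
  have inj: "inj_on e (T \<times> {..<k})"
  proof (rule inj_onI, rule ccontr)
    fix x y assume x: "x \<in> T \<times> {..<k}" and y: "y \<in> T \<times> {..<k}" and "e x = e y" "x \<noteq> y"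
    define q :: "real \<times> nat \<Rightarrow> rat" where "q z = (if z = x then 1 else if z = y then -1 else 0)" for z
    have "(\<Sum>z\<in>T\<times>{..<k}. of_rat (q z) * e z) =
        (\<Sum>z\<in>T\<times>{..<k}. (if z = x then e x else 0) - (if z = y then e y else 0))"
      using \<open>x \<noteq> y\<close> by (intro sum.cong) (auto simp: q_def)
    also have "\<dots> = 0" using x y \<open>e x = e y\<close> finT by (simp add: sum_subtractf)
    finally have "q x = 0" using zero[of q "fst x" "snd x"] x by auto
    then show False by (simp add: q_def)
  qed
  have indC: "rat_real.independent C"
  proof (rule rat_real.independent_if_scalars_zero)
    fix f x assume s: "(\<Sum>x\<in>C. of_rat (f x) * x) = 0" and x: "x \<in> C"
    then obtain t j where tj: "t \<in> T" "j < k" "x = e (t, j)" by (auto simp: C_def)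
    have "(\<Sum>z\<in>T\<times>{..<k}. of_rat (f (e z)) * e z) = 0"
      using s unfolding C_def by (subst (asm) sum.reindex[OF inj]) simp
    then show "f x = 0" using zero[of "f \<circ> e" t j] tj by simp
  qed (simp add: C_def finT)
  have CV: "C \<subseteq> V"
    using T ev_stable[OF sub, of _ "Polynomial.monom 1 _"] stable
    by (auto simp: C_def e_def V_def map_poly_monom poly_monom)
  have "V \<subseteq> rat_real.span C"
  proof
    fix v assume "v \<in> V"
    then obtain p where p: "v = (\<Sum>t\<in>T. ev (p t) * t)" using VT by blast
    have "ev (p t) * t \<in> rat_real.span C" if t: "t \<in> T" for t
    proof -
      obtain q where q: "ev q = ev (p t)" "\<forall>n\<ge>k. Polynomial.coeff q n = 0" using ev_reduce by blast
      have "ev q * t = (\<Sum>j<k. of_rat (Polynomial.coeff q j) * e (t, j))"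
        unfolding ev_eq_sum[OF q(2)] by (simp add: e_def sum_distrib_right mult.assoc)
      also have "\<dots> \<in> rat_real.span C"
        using t by (intro rat_real.span_sum rat_real.span_scale rat_real.span_base) (auto simp: C_def)
      finally show ?thesis using q by simp
    qed
    then show "v \<in> rat_real.span C" unfolding p by (rule rat_real.span_sum)
  qed
  then have spanC: "rat_real.span B = rat_real.span C"
    using CV rat_real.span_minimal[OF CV sub] V_def by blast
  have "rat_trace B a = rat_trace C a"
    by (rule rat_trace_basis_change) (use B indC spanC stable finT in \<open>auto simp: C_def\<close>)
  also have "\<dots> = 0"
    unfolding rat_trace_def
  proof (rule sum.neutral, rule ballI)
    fix x assume "x \<in> C"
    then obtain t j where tj: "t \<in> T" "j < k" "x = e (t, j)" by (auto simp: C_def)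
    show "rat_real.representation C (a * x) x = 0"
    proof (cases "Suc j < k")
      case True
      have "a * x = e (t, Suc j)" using tj by (simp add: e_def)
      moreover have "e (t, Suc j) \<in> C" "e (t, Suc j) \<noteq> x"
        using True tj inj_onD[OF inj, of "(t, Suc j)" "(t, j)"] by (auto simp: C_def)
      ultimately show ?thesis using rat_real.representation_basis[OF indC] by auto
    next
      case False
      then have "k = Suc j" using tj by simp
      then have "a * x = of_rat c * e (t, 0)" using tj power_k by (simp add: e_def)
      moreover have C0: "e (t, 0) \<in> C" using tj k_pos by (auto simp: C_def)
      moreover have "e (t, 0) \<noteq> x"
        using tj inj_onD[OF inj, of "(t, 0)" "(t, j)"] \<open>k = Suc j\<close> k by auto
      ultimately show ?thesis
        using rat_real.representation_basis[OF indC C0] rat_real.representation_scale[OF indC rat_real.span_base[OF C0]]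
        by auto
    qed
  qed
  finally show ?thesis .
qed

end

lemma rat_trace_eq_0:
  assumes a: "a > 0" "a \<notin> \<rat>" "m > 0" "a ^ m \<in> \<rat>"
    and B: "finite B" "rat_real.independent B"
    and stable: "\<And>v. v \<in> rat_real.span B \<Longrightarrow> a * v \<in> rat_real.span B"
  shows "rat_trace B a = 0"
proof -
  define k where "k = (LEAST k. 0 < k \<and> a ^ k \<in> \<rat>)"
  have k: "0 < k" "a ^ k \<in> \<rat>" using LeastI[of "\<lambda>k. 0 < k \<and> a ^ k \<in> \<rat>" m] a by (auto simp: k_def)
  then obtain c where "a ^ k = of_rat c" by (auto elim: Rats_cases)
  then interpret rational_radical a k c
    using a(1) k by unfold_locales (auto simp: k_def dest: not_less_Least)
  have "k \<noteq> 1" using a k by auto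
  then show ?thesis using k by (intro trace_eq_0 B stable) auto
qed

text \<open>The closure hypothesis makes the span of \<open>A\<close> stable under multiplication by all \<open>y / x\<close> with
  \<open>x, y \<in> A\<close>. Among these only \<open>x / x = 1\<close> has nonzero trace, so dividing a relation by \<open>x\<close> and
  taking the trace isolates the coefficient of \<open>x\<close>.\<close>

theorem radicals_independent:
  assumes A: "finite A" "\<And>x. x \<in> A \<Longrightarrow> x > 0" "\<And>x. x \<in> A \<Longrightarrow> \<exists>m>0. x ^ m \<in> \<rat>"
    and closed: "\<And>x y. x \<in> A \<Longrightarrow> y \<in> A \<Longrightarrow> x * y \<in> rat_real.span A"
    and distinct: "\<And>x y. x \<in> A \<Longrightarrow> y \<in> A \<Longrightarrow> x \<noteq> y \<Longrightarrow> x / y \<notin> \<rat>"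
  shows "rat_real.independent A"
proof (rule rat_real.independent_if_scalars_zero[OF A(1)])
  fix q x assume s: "(\<Sum>y\<in>A. of_rat (q y) * y) = 0" and x: "x \<in> A"
  obtain B where B: "B \<subseteq> A" "rat_real.independent B" "A \<subseteq> rat_real.span B"
    by (rule rat_real.maximal_independent_subset)
  define V where "V = rat_real.span B"
  have VA: "V = rat_real.span A"
    unfolding V_def
    by (intro subset_antisym rat_real.span_mono[OF B(1)] rat_real.span_minimal[OF B(3)] rat_real.subspace_span)
  have sub: "rat_real.subspace V" unfolding V_def by (rule rat_real.subspace_span)
  have finB: "finite B" using B A finite_subset by blast
  have mulA: "y * v \<in> V" if "y \<in> A" "v \<in> V" for y v
  proof -
    have "V \<subseteq> {v. y * v \<in> V}"
      unfolding VA
    proof (rule rat_real.span_minimal)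
      show "rat_real.subspace {v. y * v \<in> rat_real.span A}"
        using sub unfolding VA rat_real.subspace_def
        by (simp add: distrib_left mult.left_commute[of y])
    qed (use closed that in auto)
    then show ?thesis using that by blast
  qed
  \<comment> \<open>Division by \<open>x\<close> is multiplication by a power of \<open>x\<close>, up to a rational factor.\<close>
  have div: "y / x * v \<in> V" if "y \<in> A" "v \<in> V" for y v
  proof -
    obtain m where m: "m > 0" "x ^ m \<in> \<rat>" using A x by blast
    obtain c where c: "inverse (x ^ m) = of_rat c" by (rule Rats_cases[OF Rats_inverse[OF m(2)]])
    have pow: "x ^ n * (y * v) \<in> V" for n
      using mulA[OF that] mulA[OF x] by (induction n) (auto simp: mult.assoc)
    have "y / x * v = inverse (x ^ m) * (x ^ (m - 1) * (y * v))"
      using m A(2)[OF x] by (cases m) (auto simp: field_simps)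
    also have "\<dots> \<in> V" unfolding c using pow sub by (rule_tac rat_real.subspace_scale)
    finally show ?thesis .
  qed
  have tr: "rat_trace B (y / x) = (if y = x then of_nat (card B) else 0)" if y: "y \<in> A" for y
  proof (cases "y = x")
    case True
    then show ?thesis
      using A(2)[OF x] by (simp add: rat_trace_def rat_real.representation_basis[OF B(2)])
  next
    case False
    obtain m n where mn: "m > 0" "x ^ m \<in> \<rat>" "n > 0" "y ^ n \<in> \<rat>" using A(3)[OF x] A(3)[OF y] by blast
    have "(y / x) ^ (m * n) = (y ^ n) ^ m / (x ^ m) ^ n"
      unfolding power_divide power_mult[symmetric] by (simp add: mult.commute)
    also have "\<dots> \<in> \<rat>" using mn by simp
    finally have "rat_trace B (y / x) = 0"
      using A x y mn B finB distinct[OF y x False] div[OF y]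
      by (intro rat_trace_eq_0[of _ "m * n"]) (auto simp: V_def)
    then show ?thesis using False by simp
  qed
  have "0 = (\<Sum>b\<in>B. rat_real.representation B (\<Sum>y\<in>A. of_rat (q y) * (y / x * b)) b)"
  proof -
    have "(\<Sum>y\<in>A. of_rat (q y) * (y / x * b)) = (\<Sum>y\<in>A. of_rat (q y) * y) * (b / x)" for b
      by (simp add: sum_distrib_right sum_divide_distrib mult.assoc)
    then show ?thesis using s by (simp add: rat_real.representation_zero)
  qed
  also have "\<dots> = (\<Sum>b\<in>B. \<Sum>y\<in>A. q y * rat_real.representation B (y / x * b) b)"
  proof (rule sum.cong[OF refl])
    fix b assume "b \<in> B"
    then have "y / x * b \<in> rat_real.span B" if "y \<in> A" for y
      using div[OF that] rat_real.span_base V_def by blast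
    then show "rat_real.representation B (\<Sum>y\<in>A. of_rat (q y) * (y / x * b)) b =
        (\<Sum>y\<in>A. q y * rat_real.representation B (y / x * b) b)"
      by (subst rat_real.representation_sum)
        (auto intro!: B rat_real.span_scale simp: rat_real.representation_scale[OF B(2)]
          simp del: times_divide_eq_left times_divide_eq_right)
  qed
  also have "\<dots> = (\<Sum>y\<in>A. q y * rat_trace B (y / x))"
    by (subst sum.swap) (simp add: rat_trace_def sum_distrib_left)
  also have "\<dots> = (\<Sum>y\<in>A. if y = x then q x * of_nat (card B) else 0)"
    using tr by (intro sum.cong) auto
  also have "\<dots> = q x * of_nat (card B)" using A(1) x by simp
  finally have "q x * of_nat (card B) = 0" by simp
  moreover have "B \<noteq> {}" using B(3) x A(2)[OF x] by auto
  ultimately show "q x = 0" using finB by simp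
qed

section \<open>Integer combinations in abelian groups and monomial actions\<close>

context abelian_group
begin

lemma int_comb_closed [simp]: "B \<subseteq> carrier G \<Longrightarrow> int_comb G B c \<in> carrier G"
  unfolding int_comb_def by (rule finsum_closed) auto

lemma int_comb_cong: "(\<And>b. b \<in> B \<Longrightarrow> c b = d b) \<Longrightarrow> B \<subseteq> carrier G \<Longrightarrow> int_comb G B c = int_comb G B d"
  unfolding int_comb_def by (rule finsum_cong') auto

lemma int_comb_add:
  assumes "B \<subseteq> carrier G"
  shows "int_comb G B (\<lambda>b. c b + d b) = int_comb G B c \<oplus> int_comb G B d"
proof -
  have "int_comb G B (\<lambda>b. c b + d b) = (\<Oplus>b\<in>B. [c b] \<cdot> b \<oplus> [d b] \<cdot> b)"
    unfolding int_comb_def using assms by (intro finsum_cong') (auto intro!: add.int_pow_mult)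
  also have "\<dots> = int_comb G B c \<oplus> int_comb G B d"
    unfolding int_comb_def using assms by (intro finsum_addf) auto
  finally show ?thesis .
qed

lemma int_comb_insert:
  assumes "finite B" "b \<notin> B" "insert b B \<subseteq> carrier G"
  shows "int_comb G (insert b B) c = [c b] \<cdot> b \<oplus> int_comb G B c"
  unfolding int_comb_def using assms by (intro finsum_insert) auto

lemma int_comb_scale:
  assumes "finite B" "B \<subseteq> carrier G"
  shows "int_comb G B (\<lambda>b. n * c b) = [n] \<cdot> int_comb G B c"
  using assms
proof (induction B)
  case (insert b B)
  then show ?case
    by (simp add: int_comb_insert add.int_pow_distrib add.int_pow_pow mult.commute)
qed (simp add: int_comb_def)

lemma int_comb_zero: "B \<subseteq> carrier G \<Longrightarrow> int_comb G B (\<lambda>_. 0) = \<zero>"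
  unfolding int_comb_def by (rule add.finprod_one_eqI) (auto simp: add_pow_def)

lemma int_comb_single:
  assumes "finite B" "B \<subseteq> carrier G" "b \<in> B"
  shows "int_comb G B (\<lambda>x. if x = b then n else 0) = [n] \<cdot> b"
proof -
  have "int_comb G B (\<lambda>x. if x = b then n else 0) =
      int_comb G (insert b (B - {b})) (\<lambda>x. if x = b then n else 0)"
    using assms by (simp add: insert_absorb)
  also have "\<dots> = [n] \<cdot> b \<oplus> int_comb G (B - {b}) (\<lambda>x. if x = b then n else 0)"
    using assms by (subst int_comb_insert) auto
  also have "int_comb G (B - {b}) (\<lambda>x. if x = b then n else 0) = int_comb G (B - {b}) (\<lambda>_. 0)"
    using assms by (intro int_comb_cong) auto
  also have "int_comb G (B - {b}) (\<lambda>_. 0) = \<zero>" using assms by (intro int_comb_zero) auto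
  finally show ?thesis using assms by auto
qed

lemma int_comb_induct:
  assumes "finite B" "B \<subseteq> carrier G"
    and "P \<zero>" "\<And>b n. b \<in> B \<Longrightarrow> P ([(n::int)] \<cdot> b)"
    and "\<And>x y. x \<in> carrier G \<Longrightarrow> y \<in> carrier G \<Longrightarrow> P x \<Longrightarrow> P y \<Longrightarrow> P (x \<oplus> y)"
  shows "P (int_comb G B c)"
  using assms(1,2,4)
proof (induction B)
  case empty
  then show ?case using assms(3) by (simp add: int_comb_def)
next
  case (insert b B)
  then have "P ([c b] \<cdot> b \<oplus> int_comb G B c)" by (intro assms(5)) auto
  then show ?case using insert by (simp add: int_comb_insert)
qed

end

text \<open>Coordinates with respect to a \<open>\<int>\<close>-basis; only the values at elements of \<open>B\<close> are determined.\<close>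

definition coord :: "('a, 'z) ring_scheme \<Rightarrow> 'a set \<Rightarrow> 'a \<Rightarrow> 'a \<Rightarrow> int" where
  "coord G B x = (SOME c. int_comb G B c = x)"

locale free_abelian = abelian_group G for G (structure) and B +
  assumes basis: "int_basis G B"
begin

lemma finite_basis: "finite B" and basis_carrier: "B \<subseteq> carrier G"
  and span_basis: "int_span G B = carrier G"
  using basis by (auto simp: int_basis_def)

lemma basis_in_carrier: "b \<in> B \<Longrightarrow> b \<in> carrier G" using basis_carrier by blast

lemma int_comb_unique:
  assumes "int_comb G B c = int_comb G B d" "b \<in> B"
  shows "c b = d b"
proof -
  have "int_comb G B (\<lambda>b. c b + (- 1) * d b) = int_comb G B c \<oplus> [(- 1 :: int)] \<cdot> int_comb G B d"
    by (simp only: int_comb_add[OF basis_carrier] int_comb_scale[OF finite_basis basis_carrier])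
  also have "\<dots> = \<zero>"
    unfolding assms(1) using basis_carrier by (simp add: add.int_pow_neg r_neg)
  finally show ?thesis using basis assms(2) by (auto simp: int_basis_def)
qed

lemma int_comb_coord:
  assumes "x \<in> carrier G"
  shows "int_comb G B (coord G B x) = x"
proof -
  obtain c where "int_comb G B c = x"
    using assms unfolding span_basis[symmetric] int_span_def by blast
  then show ?thesis unfolding coord_def by (rule someI[of "\<lambda>c. int_comb G B c = x"])
qed

lemma coord_int_comb: "b \<in> B \<Longrightarrow> coord G B (int_comb G B c) b = c b"
  using int_comb_coord[of "int_comb G B c"] basis_carrier by (auto intro: int_comb_unique)

lemma coord_add:
  assumes "x \<in> carrier G" "y \<in> carrier G" "b \<in> B"
  shows "coord G B (x \<oplus> y) b = coord G B x b + coord G B y b"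
proof -
  have "x \<oplus> y = int_comb G B (\<lambda>b. coord G B x b + coord G B y b)"
    using assms by (simp add: int_comb_add basis_carrier int_comb_coord)
  then show ?thesis using assms(3) coord_int_comb by simp
qed

lemma coord_scale:
  assumes "x \<in> carrier G" "b \<in> B"
  shows "coord G B ([(n::int)] \<cdot> x) b = n * coord G B x b"
proof -
  have "[n] \<cdot> x = int_comb G B (\<lambda>b. n * coord G B x b)"
    using assms by (simp add: int_comb_scale finite_basis basis_carrier int_comb_coord)
  then show ?thesis using assms coord_int_comb by simp
qed

lemma coord_zero: "b \<in> B \<Longrightarrow> coord G B \<zero> b = 0"
  using coord_int_comb[of b "\<lambda>_. 0"] by (simp add: int_comb_zero basis_carrier)

lemma coord_basis:
  assumes "b \<in> B" "b' \<in> B"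
  shows "coord G B b b' = (if b' = b then 1 else 0)"
  using coord_int_comb[OF assms(2), of "\<lambda>x. if x = b then 1 else 0"] basis_carrier
  by (simp add: int_comb_single finite_basis assms subset_eq)

lemma eq_by_coord:
  assumes "x \<in> carrier G" "y \<in> carrier G" "\<And>b. b \<in> B \<Longrightarrow> coord G B x b = coord G B y b"
  shows "x = y"
proof -
  have "int_comb G B (coord G B x) = int_comb G B (coord G B y)"
    using assms(3) by (rule int_comb_cong[OF _ basis_carrier])
  then show ?thesis using assms(1,2) by (simp add: int_comb_coord)
qed

lemma carrier_induct [consumes 1, case_names zero basis add]:
  assumes "x \<in> carrier G"
    and "P \<zero>" "\<And>b n. b \<in> B \<Longrightarrow> P ([(n::int)] \<cdot> b)"
    and "\<And>x y. x \<in> carrier G \<Longrightarrow> y \<in> carrier G \<Longrightarrow> P x \<Longrightarrow> P y \<Longrightarrow> P (x \<oplus> y)"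
  shows "P x"
proof -
  have "P (int_comb G B (coord G B x))"
    using assms(2-4) by (rule int_comb_induct[OF finite_basis basis_carrier])
  then show ?thesis using assms(1) by (simp add: int_comb_coord)
qed

lemma hom_scale:
  assumes f: "f \<in> carrier G \<rightarrow> carrier G"
      "\<And>x y. x \<in> carrier G \<Longrightarrow> y \<in> carrier G \<Longrightarrow> f (x \<oplus> y) = f x \<oplus> f y"
    and x: "x \<in> carrier G"
  shows "f ([(n::int)] \<cdot> x) = [n] \<cdot> f x"
proof -
  have "f \<in> hom (add_monoid G) (add_monoid G)" using f by (auto simp: hom_def)
  then show ?thesis
    using hom_int_pow[of f "add_monoid G" "add_monoid G" x n] x add.group_axioms a_group
    by (simp add: add_pow_def)
qed

text \<open>Matrix form of an additive map, which turns statements on compositions of actions into matrix products.\<close>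

lemma coord_endomorphism:
  assumes f: "f \<in> carrier G \<rightarrow> carrier G"
      "\<And>x y. x \<in> carrier G \<Longrightarrow> y \<in> carrier G \<Longrightarrow> f (x \<oplus> y) = f x \<oplus> f y"
    and x: "x \<in> carrier G" and l: "l \<in> B"
  shows "coord G B (f x) l = (\<Sum>k\<in>B. coord G B x k * coord G B (f k) l)"
  using x
proof (induction rule: carrier_induct)
  case zero
  have "f ([(0::int)] \<cdot> \<zero>) = [(0::int)] \<cdot> f \<zero>" by (rule hom_scale[OF f]) auto
  then have "f \<zero> = \<zero>" by (simp add: add_pow_def)
  then show ?case using l by (simp add: coord_zero)
next
  case (basis b n)
  have "coord G B (f ([n] \<cdot> b)) l = n * coord G B (f b) l"
    using basis l f(1) basis_in_carrier by (subst hom_scale[OF f]) (auto intro: coord_scale)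
  also have "\<dots> = (\<Sum>k\<in>B. if k = b then n * coord G B (f b) l else 0)"
    using basis finite_basis by simp
  also have "\<dots> = (\<Sum>k\<in>B. coord G B ([n] \<cdot> b) k * coord G B (f k) l)"
    using basis basis_in_carrier by (intro sum.cong) (auto simp: coord_scale coord_basis)
  finally show ?case .
next
  case (add x y)
  then have "coord G B (f (x \<oplus> y)) l = coord G B (f x) l + coord G B (f y) l"
    unfolding f(2)[OF add(1,2)] using f(1) l by (intro coord_add) auto
  then show ?case
    using add by (simp add: coord_add algebra_simps sum.distrib)
qed

end

lemma (in module) smult_add_pow:
  assumes "a \<in> carrier R" "x \<in> carrier M"
  shows "([(n::int)] \<cdot>\<^bsub>R\<^esub> a) \<odot>\<^bsub>M\<^esub> x = [n] \<cdot>\<^bsub>M\<^esub> (a \<odot>\<^bsub>M\<^esub> x)"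
proof -
  have "(\<lambda>a. a \<odot>\<^bsub>M\<^esub> x) \<in> hom (add_monoid R) (add_monoid M)"
    using assms by (auto simp: hom_def smult_l_distr)
  then show ?thesis
    using hom_int_pow[of "\<lambda>a. a \<odot>\<^bsub>M\<^esub> x" "add_monoid R" "add_monoid M" a n] assms
      R.a_group M.a_group
    by (simp add: add_pow_def)
qed

sublocale zplus_module \<subseteq> free: free_abelian M B
  by unfold_locales (rule module_basis)

context zplus_module
begin

lemma A_carrier: "x \<in> A \<Longrightarrow> x \<in> carrier R"
  using ring_basis by (auto simp: int_basis_def)

lemma coord_smult_nonneg:
  assumes "x \<in> A" "m \<in> B" "k \<in> B"
  shows "coord M B (x \<odot>\<^bsub>M\<^esub> m) k \<ge> 0"
  using basis_smult[OF assms(1,2)] free.coord_int_comb[OF assms(3)] assms(3)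
  by (auto simp: nonneg_span_def)

lemma smult_scale:
  assumes "x \<in> carrier R" "m \<in> carrier M"
  shows "x \<odot>\<^bsub>M\<^esub> ([(n::int)] \<cdot>\<^bsub>M\<^esub> m) = [n] \<cdot>\<^bsub>M\<^esub> (x \<odot>\<^bsub>M\<^esub> m)"
  using assms by (intro free.hom_scale) (auto simp: smult_r_distr)

lemma coord_smult:
  assumes "x \<in> carrier R" "m \<in> carrier M" "l \<in> B"
  shows "coord M B (x \<odot>\<^bsub>M\<^esub> m) l = (\<Sum>k\<in>B. coord M B m k * coord M B (x \<odot>\<^bsub>M\<^esub> k) l)"
  using assms by (intro free.coord_endomorphism) (auto simp: smult_r_distr)

text \<open>If \<open>xy\<close> is a positive integer \<open>n\<close>, then the nonnegative matrices of \<open>x\<close> and \<open>y\<close> have product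
  \<open>n\<close> times the identity. No cancellation is possible in such a product, which forces both matrices to be monomial.\<close>

lemma monomial_action:
  assumes x: "x \<in> A" and y: "y \<in> A" and xy: "x \<otimes> y = [(n::int)] \<cdot> \<one>" and n: "n > 0" and b: "b \<in> B"
  shows "\<exists>k\<in>B. \<exists>w>0. x \<odot>\<^bsub>M\<^esub> b = [(w::int)] \<cdot>\<^bsub>M\<^esub> k"
proof -
  note carr = A_carrier[OF x] A_carrier[OF y] free.basis_in_carrier
  have xym: "x \<odot>\<^bsub>M\<^esub> (y \<odot>\<^bsub>M\<^esub> m) = [n] \<cdot>\<^bsub>M\<^esub> m" if "m \<in> carrier M" for m
    using that carr xy by (simp add: smult_assoc1[symmetric] smult_add_pow)
  have yxm: "y \<odot>\<^bsub>M\<^esub> (x \<odot>\<^bsub>M\<^esub> m) = [n] \<cdot>\<^bsub>M\<^esub> m" if "m \<in> carrier M" for m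
    using that carr xy by (simp add: smult_assoc1[symmetric] smult_add_pow m_comm)
  let ?c = "coord M B"
  have yxb: "(\<Sum>k\<in>B. ?c (x \<odot>\<^bsub>M\<^esub> b) k * ?c (y \<odot>\<^bsub>M\<^esub> k) l) = n * (if l = b then 1 else 0)" if "l \<in> B" for l
  proof -
    have "(\<Sum>k\<in>B. ?c (x \<odot>\<^bsub>M\<^esub> b) k * ?c (y \<odot>\<^bsub>M\<^esub> k) l) = ?c ([n] \<cdot>\<^bsub>M\<^esub> b) l"
      using coord_smult[of y "x \<odot>\<^bsub>M\<^esub> b" l] carr b that by (simp add: yxm)
    then show ?thesis using that b carr by (simp add: free.coord_scale free.coord_basis)
  qed
  obtain k where k: "k \<in> B" "?c (x \<odot>\<^bsub>M\<^esub> b) k \<noteq> 0"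
  proof (rule ccontr)
    assume "\<not> thesis"
    with that have "\<forall>k\<in>B. ?c (x \<odot>\<^bsub>M\<^esub> b) k = 0" by blast
    then show False using yxb[OF b] n by simp
  qed
  then have k0: "?c (x \<odot>\<^bsub>M\<^esub> b) k > 0" using coord_smult_nonneg[OF x b] by force
  \<comment> \<open>The entry of \<open>yx\<close> at \<open>l \<noteq> b\<close> is a vanishing sum of nonnegative terms, and \<open>k\<close> occurs with a positive factor.\<close>
  have yk: "?c (y \<odot>\<^bsub>M\<^esub> k) l = 0" if l: "l \<in> B" "l \<noteq> b" for l
  proof -
    have "(\<Sum>k\<in>B. ?c (x \<odot>\<^bsub>M\<^esub> b) k * ?c (y \<odot>\<^bsub>M\<^esub> k) l) = 0" using yxb l by simp
    then have "?c (x \<odot>\<^bsub>M\<^esub> b) k * ?c (y \<odot>\<^bsub>M\<^esub> k) l = 0"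
      using k(1) free.finite_basis coord_smult_nonneg x y b l(1)
      by (subst (asm) sum_nonneg_eq_0_iff) auto
    then show ?thesis using k0 by simp
  qed
  define e where "e = ?c (y \<odot>\<^bsub>M\<^esub> k) b"
  have "y \<odot>\<^bsub>M\<^esub> k = [e] \<cdot>\<^bsub>M\<^esub> b"
    using yk k b carr by (intro free.eq_by_coord) (auto simp: free.coord_scale free.coord_basis e_def)
  then have "[e] \<cdot>\<^bsub>M\<^esub> (x \<odot>\<^bsub>M\<^esub> b) = [n] \<cdot>\<^bsub>M\<^esub> k"
    using xym[of k] k b carr by (simp add: smult_scale)
  then have eq: "e * ?c (x \<odot>\<^bsub>M\<^esub> b) j = n * ?c k j" if "j \<in> B" for j
    using free.coord_scale[of "x \<odot>\<^bsub>M\<^esub> b" j e] free.coord_scale[of k j n] that k b carr by simp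
  have "e \<noteq> 0" using eq[OF k(1)] n k(1) by (auto simp: free.coord_basis)
  then have "?c (x \<odot>\<^bsub>M\<^esub> b) j = 0" if "j \<in> B" "j \<noteq> k" for j
    using eq[OF that(1)] that k(1) by (simp add: free.coord_basis)
  then have "x \<odot>\<^bsub>M\<^esub> b = [?c (x \<odot>\<^bsub>M\<^esub> b) k] \<cdot>\<^bsub>M\<^esub> k"
    using k b carr by (intro free.eq_by_coord) (auto simp: free.coord_scale free.coord_basis)
  then show ?thesis using k(1) k0 by blast
qed

end

section \<open>Lattices of radicals\<close>

context abelian_group
begin

context
  fixes g :: "'a \<Rightarrow> real"
  assumes g: "\<And>x y. x \<in> carrier G \<Longrightarrow> y \<in> carrier G \<Longrightarrow> g (x \<oplus> y) = g x + g y"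
begin

lemma additive_zero: "g \<zero> = 0"
  using g[of \<zero> \<zero>] by simp

lemma additive_add_pow:
  assumes x: "x \<in> carrier G"
  shows "g ([(n::int)] \<cdot> x) = of_int n * g x"
proof (induction n rule: int_induct[where k = 0])
  case base
  then show ?case by (simp add: add_pow_def additive_zero)
next
  case (step1 i)
  have "[(i + 1)] \<cdot> x = [i] \<cdot> x \<oplus> x" using x by (simp add: add.int_pow_mult)
  then show ?case using step1 x by (simp add: g algebra_simps)
next
  case (step2 i)
  have "[(i - 1 + 1)] \<cdot> x = [(i - 1)] \<cdot> x \<oplus> [(1::int)] \<cdot> x"
    using x by (intro add.int_pow_mult)
  then have "g ([i] \<cdot> x) = g ([(i - 1)] \<cdot> x \<oplus> x)" using x by simp
  also have "\<dots> = g ([(i - 1)] \<cdot> x) + g x" using x by (intro g) auto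
  finally have "g ([i] \<cdot> x) = g ([(i - 1)] \<cdot> x) + g x" .
  then show ?case using step2 by (simp add: algebra_simps)
qed

lemma additive_int_comb:
  assumes "finite B" "B \<subseteq> carrier G"
  shows "g (int_comb G B c) = (\<Sum>b\<in>B. of_int (c b) * g b)"
  using assms
proof (induction B)
  case empty
  then show ?case by (simp add: int_comb_def additive_zero)
next
  case (insert b B)
  then show ?case by (simp add: int_comb_insert g additive_add_pow)
qed

end

end

lemma int_independent:
  assumes "rat_real.independent U" "finite U" "(\<Sum>u\<in>U. of_int (c u) * u) = 0" "u \<in> U"
  shows "c u = 0"
proof -
  have "\<forall>f. (\<Sum>u\<in>U. of_rat (f u) * u) = 0 \<longrightarrow> (\<forall>u\<in>U. f u = 0)"
    using assms(1,2) unfolding rat_real.independent_explicit_finite_subsets by blast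
  from spec[OF this, of "\<lambda>u. of_int (c u)"] show ?thesis using assms(3,4) by simp
qed

definition int_lattice :: "real set \<Rightarrow> real set" where
  "int_lattice U = {\<Sum>u\<in>U. of_int (c u) * u | c. True}"

lemma int_latticeI: "(\<Sum>u\<in>U. of_int (c u) * u) \<in> int_lattice U"
  by (auto simp: int_lattice_def)

lemma int_lattice_add: "x \<in> int_lattice U \<Longrightarrow> y \<in> int_lattice U \<Longrightarrow> x + y \<in> int_lattice U"
  unfolding int_lattice_def
  by (clarsimp, rule_tac x = "\<lambda>u. c u + ca u" in exI) (simp add: sum.distrib distrib_right)

lemma int_lattice_scale: "x \<in> int_lattice U \<Longrightarrow> of_int n * x \<in> int_lattice U"
  unfolding int_lattice_def
  by (clarsimp, rule_tac x = "\<lambda>u. n * c u" in exI) (simp add: sum_distrib_left mult.assoc)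

lemma int_lattice_0: "0 \<in> int_lattice U"
  using int_latticeI[of "\<lambda>_. 0" U] by simp

lemma int_lattice_minus: "x \<in> int_lattice U \<Longrightarrow> - x \<in> int_lattice U"
  using int_lattice_scale[of x U "- 1"] by simp

lemma int_lattice_base:
  assumes "finite U" "u \<in> U"
  shows "u \<in> int_lattice U"
proof -
  have "(\<Sum>x\<in>U. of_int (if x = u then 1 else 0) * x) = (\<Sum>x\<in>U. if x = u then u else 0)"
    by (rule sum.cong) auto
  then show ?thesis using int_latticeI[of "\<lambda>x. if x = u then 1 else 0" U] assms by simp
qed

lemma int_lattice_sum: "(\<And>i. i \<in> S \<Longrightarrow> f i \<in> int_lattice U) \<Longrightarrow> sum f S \<in> int_lattice U"
  by (induction S rule: infinite_finite_induct) (auto intro: int_lattice_0 int_lattice_add)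

lemma int_lattice_mult:
  assumes "\<And>a u. a \<in> A \<Longrightarrow> u \<in> U \<Longrightarrow> a * u \<in> int_lattice U"
    and "x \<in> int_lattice A" "y \<in> int_lattice U"
  shows "x * y \<in> int_lattice U"
proof -
  obtain c d where x: "x = (\<Sum>a\<in>A. of_int (c a) * a)" and y: "y = (\<Sum>u\<in>U. of_int (d u) * u)"
    using assms by (auto simp: int_lattice_def)
  have "x * y = (\<Sum>a\<in>A. \<Sum>u\<in>U. of_int (c a) * (of_int (d u) * (a * u)))"
    by (simp add: x y sum_product algebra_simps)
  also have "\<dots> \<in> int_lattice U"
    using assms(1) by (intro int_lattice_sum int_lattice_scale)
  finally show ?thesis .
qed

locale coprime_radicals =
  fixes r :: nat and d N :: "nat \<Rightarrow> nat"
  assumes d_ge: "\<And>j. j \<in> {1..r} \<Longrightarrow> 2 \<le> d j"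
    and d_squarefree: "\<And>j. j \<in> {1..r} \<Longrightarrow> squarefree (d j)"
    and d_coprime: "pairwise (\<lambda>i j. coprime (d i) (d j)) {1..r}"
    and N_ge: "\<And>j. j \<in> {1..r} \<Longrightarrow> 2 \<le> N j"
begin

text \<open>Exponent vectors, which represent the product of the cyclic groups \<open>\<int>/N\<^sub>s\<close>; entries outside
  \<open>{1..r}\<close> are \<open>0\<close> so that vectors are equal when they agree on \<open>{1..r}\<close>.\<close>

definition I :: "(nat \<Rightarrow> nat) set" where
  "I = {i. (\<forall>s\<in>{1..r}. i s < N s) \<and> (\<forall>s. s \<notin> {1..r} \<longrightarrow> i s = 0)}"

definition v :: "(nat \<Rightarrow> nat) \<Rightarrow> real" where
  "v i = (\<Prod>s=1..r. root (N s) (real (d s)) ^ i s)"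

definition plus :: "(nat \<Rightarrow> nat) \<Rightarrow> (nat \<Rightarrow> nat) \<Rightarrow> nat \<Rightarrow> nat" (infixl \<open>\<oplus>\<^sub>I\<close> 65) where
  "i \<oplus>\<^sub>I j = (\<lambda>s. if s \<in> {1..r} then (i s + j s) mod N s else 0)"

definition minus :: "(nat \<Rightarrow> nat) \<Rightarrow> (nat \<Rightarrow> nat) \<Rightarrow> nat \<Rightarrow> nat" (infixl \<open>\<ominus>\<^sub>I\<close> 65) where
  "i \<ominus>\<^sub>I j = (\<lambda>s. if s \<in> {1..r} then (i s + (N s - j s)) mod N s else 0)"

text \<open>The factor by which \<open>v\<close> fails to be multiplicative: each coordinate that overflows contributes
  \<open>d\<^sub>s\<close>.\<close>

definition carry :: "(nat \<Rightarrow> nat) \<Rightarrow> (nat \<Rightarrow> nat) \<Rightarrow> nat" where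
  "carry i j = (\<Prod>s\<in>{s\<in>{1..r}. N s \<le> i s + j s}. d s)"

lemma N_pos: "s \<in> {1..r} \<Longrightarrow> N s > 0" and d_pos: "s \<in> {1..r} \<Longrightarrow> d s > 0"
  using N_ge d_ge by fastforce+

lemma I_less: "i \<in> I \<Longrightarrow> s \<in> {1..r} \<Longrightarrow> i s < N s" by (simp add: I_def)

lemma I_eqI:
  assumes "i \<in> I" "j \<in> I" "\<And>s. s \<in> {1..r} \<Longrightarrow> i s = j s"
  shows "i = j"
proof
  fix s show "i s = j s" using assms by (cases "s \<in> {1..r}") (auto simp: I_def)
qed

lemma zero_I: "(\<lambda>_. 0) \<in> I" using N_pos by (simp add: I_def)

lemma plus_I: "i \<oplus>\<^sub>I j \<in> I" and minus_I: "i \<ominus>\<^sub>I j \<in> I"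
  using N_pos by (auto simp: I_def plus_def minus_def)

lemma plus_minus:
  assumes "i \<in> I" "j \<in> I"
  shows "j \<oplus>\<^sub>I (i \<ominus>\<^sub>I j) = i"
proof (rule I_eqI[OF plus_I assms(1)])
  fix s assume s: "s \<in> {1..r}"
  have "(j \<oplus>\<^sub>I (i \<ominus>\<^sub>I j)) s = (j s + (i s + (N s - j s))) mod N s"
    using s by (simp add: plus_def minus_def mod_simps)
  also have "j s + (i s + (N s - j s)) = i s + N s" using I_less[OF assms(2) s] by simp
  finally show "(j \<oplus>\<^sub>I (i \<ominus>\<^sub>I j)) s = i s" using I_less[OF assms(1) s] by simp
qed

lemma plus_zero: "i \<in> I \<Longrightarrow> i \<oplus>\<^sub>I (\<lambda>_. 0) = i"
  by (rule I_eqI[OF plus_I]) (auto simp: I_less plus_def)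

lemma plus_commute: "i \<oplus>\<^sub>I j = j \<oplus>\<^sub>I i"
  by (rule ext) (simp add: plus_def Groups.add.commute)

lemma v_zero: "v (\<lambda>_. 0) = 1" by (simp add: v_def)

lemma root_pos: "s \<in> {1..r} \<Longrightarrow> root (N s) (real (d s)) > 0"
  using N_pos d_pos by (simp add: real_root_gt_zero)

lemma root_power: "s \<in> {1..r} \<Longrightarrow> root (N s) (real (d s)) ^ N s = real (d s)"
  using N_pos by (simp add: real_root_pow_pos2)

lemma v_pos: "v i > 0"
  unfolding v_def using root_pos by (intro prod_pos) auto

lemma carry_pos: "carry i j > 0"
  unfolding carry_def using d_pos by (intro prod_pos) auto

lemma v_mult:
  assumes "i \<in> I" "j \<in> I"
  shows "v i * v j = real (carry i j) * v (i \<oplus>\<^sub>I j)"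
proof -
  have "root (N s) (real (d s)) ^ i s * root (N s) (real (d s)) ^ j s =
      (if N s \<le> i s + j s then real (d s) else 1) * root (N s) (real (d s)) ^ ((i \<oplus>\<^sub>I j) s)"
    (is "?l = ?r") if s: "s \<in> {1..r}" for s
  proof (cases "N s \<le> i s + j s")
    case True
    have lt: "i s + j s < 2 * N s" using I_less[OF assms(1) s] I_less[OF assms(2) s] by simp
    then have "(i \<oplus>\<^sub>I j) s = i s + j s - N s" using True s by (simp add: plus_def mod_if)
    then have "?r = root (N s) (real (d s)) ^ N s * root (N s) (real (d s)) ^ (i s + j s - N s)"
      using True s by (simp add: root_power)
    also have "\<dots> = ?l" using True by (simp add: power_add[symmetric])
    finally show ?thesis by simp
  next
    case False
    then show ?thesis using s by (simp add: plus_def power_add)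
  qed
  then have "v i * v j = (\<Prod>s=1..r. (if N s \<le> i s + j s then real (d s) else 1)) * v (i \<oplus>\<^sub>I j)"
    unfolding v_def prod.distrib[symmetric] by (rule prod.cong[OF refl])
  also have "(\<Prod>s=1..r. (if N s \<le> i s + j s then real (d s) else 1)) = real (carry i j)"
    unfolding carry_def of_nat_prod by (rule prod.inter_filter[symmetric]) simp
  finally show ?thesis .
qed

lemma multiplicity_d:
  assumes "s \<in> {1..r}" "p \<in> prime_factors (d s)" "t \<in> {1..r}"
  shows "multiplicity p (d t) = (if t = s then 1 else 0)"
proof (cases "t = s")
  case True
  then show ?thesis
    using assms d_squarefree[OF assms(1)] d_pos[OF assms(1)] by (simp add: squarefree_factorial_semiring')
next
  case False
  then have "coprime (d s) (d t)" using d_coprime assms by (auto simp: pairwise_def)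
  then have "\<not> p dvd d t"
    using assms(2) coprime_common_divisor[of "d s" "d t" p] by (auto simp: in_prime_factors_iff)
  then show ?thesis using False by (simp add: not_dvd_imp_multiplicity_0)
qed

lemma multiplicity_prod_d:
  assumes "s \<in> {1..r}" "p \<in> prime_factors (d s)" "S \<subseteq> {1..r}"
  shows "multiplicity p (\<Prod>t\<in>S. d t ^ e t) = (if s \<in> S then e s else 0)"
proof -
  have fin: "finite S" using assms(3) finite_subset by blast
  have p: "prime_elem p" using assms(2) by auto
  have "0 \<notin> (\<lambda>t. d t ^ e t) ` S" using assms(3) d_pos by fastforce
  then have "multiplicity p (\<Prod>t\<in>S. d t ^ e t) = (\<Sum>t\<in>S. multiplicity p (d t ^ e t))"
    by (rule prime_elem_multiplicity_prod_distrib[OF p _ fin])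
  also have "\<dots> = (\<Sum>t\<in>S. if t = s then e s else 0)"
  proof (rule sum.cong[OF refl])
    fix t assume "t \<in> S"
    then have t: "t \<in> {1..r}" using assms(3) by blast
    have "multiplicity p (d t ^ e t) = e t * multiplicity p (d t)"
      using d_pos[OF t] by (intro prime_elem_multiplicity_power_distrib[OF p]) simp
    then show "multiplicity p (d t ^ e t) = (if t = s then e s else 0)"
      using multiplicity_d[OF assms(1,2) t] by simp
  qed
  finally show ?thesis using fin by simp
qed

text \<open>A common exponent: all \<open>L\<close>-th powers of the \<open>v\<^sub>i\<close> are integers.\<close>

definition L :: nat where "L = (\<Prod>s=1..r. N s)"

lemma L_pos: "L > 0" unfolding L_def using N_pos by (intro prod_pos) auto

lemma L_eq: "s \<in> {1..r} \<Longrightarrow> L = N s * (L div N s)"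
  unfolding L_def by (intro dvd_mult_div_cancel[symmetric] dvd_prodI) auto

lemma v_power: "v i ^ L = real (\<Prod>s=1..r. d s ^ (i s * (L div N s)))"
proof -
  have "(root (N s) (real (d s)) ^ i s) ^ L = real (d s) ^ (i s * (L div N s))" if s: "s \<in> {1..r}" for s
  proof -
    obtain q where q: "q = L div N s" by blast
    then have Lq: "L = N s * q" using L_eq[OF s] by simp
    have "(root (N s) (real (d s)) ^ i s) ^ L = root (N s) (real (d s)) ^ (N s * (i s * q))"
      unfolding power_mult[symmetric] by (simp add: Lq mult.left_commute)
    also have "\<dots> = real (d s) ^ (i s * q)" using s by (simp add: power_mult root_power)
    finally show ?thesis using q by simp
  qed
  then show ?thesis by (simp add: v_def prod_power_distrib)
qed

text \<open>For a prime \<open>p\<close> dividing \<open>d\<^sub>s\<close>, the \<open>p\<close>-adic valuation of \<open>v\<^sub>i\<close> is \<open>i\<^sub>s / N\<^sub>s\<close>, as \<open>d\<^sub>s\<close> is square-free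
  and the other \<open>d\<^sub>t\<close> are prime to \<open>p\<close>; it is an integer if \<open>v\<^sub>i\<close> is rational. The proof compares valuations
  of \<open>L\<close>-th powers to stay within the natural numbers.\<close>

lemma v_rational_imp_zero:
  assumes i: "i \<in> I" and rat: "v i \<in> \<rat>"
  shows "i = (\<lambda>_. 0)"
proof (rule I_eqI[OF i zero_I])
  fix s assume s: "s \<in> {1..r}"
  obtain a b :: nat where ab: "b \<noteq> 0" "\<bar>v i\<bar> = real a / real b"
    by (rule Rats_abs_nat_div_natE[OF rat])
  then have v: "v i * real b = real a" using v_pos[of i] by simp
  then have "a \<noteq> 0" using v_pos[of i] ab(1) by (metis mult_eq_0_iff of_nat_eq_0_iff less_irrefl)
  have "real a ^ L = real (\<Prod>s=1..r. d s ^ (i s * (L div N s))) * real b ^ L"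
    unfolding v_power[symmetric] v[symmetric] by (simp add: power_mult_distrib)
  then have eq: "a ^ L = (\<Prod>s=1..r. d s ^ (i s * (L div N s))) * b ^ L"
    by (simp only: of_nat_mult[symmetric] of_nat_power[symmetric] of_nat_eq_iff)
  obtain p where p: "normalization_semidom_class.prime p" "p dvd d s" using d_ge[OF s] prime_factor_nat[of "d s"] by auto
  then have pf: "p \<in> prime_factors (d s)" using d_pos[OF s] by (simp add: in_prime_factors_iff)
  have pe: "prime_elem p" using p by simp
  define K where "K = (\<Prod>s=1..r. d s ^ (i s * (L div N s)))"
  have mK: "multiplicity p K = i s * (L div N s)"
    unfolding K_def using multiplicity_prod_d[OF s pf, of "{1..r}"] s by simp
  have nz: "K \<noteq> 0" unfolding K_def using d_pos by fastforce
  have mult_eq: "L * multiplicity p a = i s * (L div N s) + L * multiplicity p b"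
    using arg_cong[OF eq[folded K_def], of "multiplicity p"] ab(1) \<open>a \<noteq> 0\<close> nz mK
    by (simp add: prime_elem_multiplicity_power_distrib[OF pe] prime_elem_multiplicity_mult_distrib[OF pe])
  obtain q where q: "L div N s = q" by blast
  then have Lq: "L = N s * q" using L_eq[OF s] by simp
  have "q * (N s * multiplicity p a) = q * (i s + N s * multiplicity p b)"
    using mult_eq N_pos[OF s] unfolding q Lq by (simp add: algebra_simps)
  then have "N s * multiplicity p a = i s + N s * multiplicity p b" using L_pos Lq by simp
  then have "N s dvd i s + N s * multiplicity p b" by (metis dvd_triv_left)
  then have "N s dvd i s" by (simp add: dvd_add_left_iff)
  then show "i s = 0" using I_less[OF i s] by (auto dest: dvd_imp_le)
qed

lemma v_ratio_rational:
  assumes "i \<in> I" "j \<in> I" and rat: "v i / v j \<in> \<rat>"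
  shows "i = j"
proof -
  have "v j * v (i \<ominus>\<^sub>I j) = real (carry j (i \<ominus>\<^sub>I j)) * v i"
    using v_mult[OF assms(2) minus_I] plus_minus[OF assms(1,2)] by simp
  then have "v (i \<ominus>\<^sub>I j) = real (carry j (i \<ominus>\<^sub>I j)) * (v i / v j)"
    using v_pos[of j] by (simp add: field_simps)
  also have "\<dots> \<in> \<rat>" using rat by (intro Rats_mult) auto
  finally have "i \<ominus>\<^sub>I j = (\<lambda>_. 0)" using v_rational_imp_zero minus_I by blast
  then show ?thesis using plus_minus[OF assms(1,2)] plus_zero[OF assms(2)] by simp
qed

lemma finite_I: "finite I"
proof -
  have "finite {i. \<forall>s. (s \<in> {1..r} \<longrightarrow> i s \<in> {..<Max (N ` {1..r})}) \<and> (s \<notin> {1..r} \<longrightarrow> i s = 0)}"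
    by (rule finite_set_of_finite_funs) auto
  moreover have "i s < Max (N ` {1..r})" if "i \<in> I" "s \<in> {1..r}" for i s
    using I_less[OF that] that(2) by (meson Max_ge finite_atLeastAtMost finite_imageI imageI less_le_trans)
  then have "I \<subseteq> {i. \<forall>s. (s \<in> {1..r} \<longrightarrow> i s \<in> {..<Max (N ` {1..r})}) \<and> (s \<notin> {1..r} \<longrightarrow> i s = 0)}"
    by (auto simp: I_def)
  ultimately show ?thesis by (rule rev_finite_subset)
qed

lemma root_basis_eq: "root_basis r d N = v ` I"
proof
  show "v ` I \<subseteq> root_basis r d N"
    using N_pos by (fastforce simp: root_basis_def v_def I_def)
  show "root_basis r d N \<subseteq> v ` I"
  proof
    fix x assume "x \<in> root_basis r d N"
    then obtain i where x: "x = v i" and i: "\<forall>s\<in>{1..r}. i s \<le> N s - 1"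
      by (auto simp: root_basis_def v_def)
    let ?j = "\<lambda>s. if s \<in> {1..r} then i s else 0"
    have "v ?j = v i" unfolding v_def by (rule prod.cong) auto
    moreover have "?j \<in> I" unfolding I_def using i N_pos by fastforce
    ultimately show "x \<in> v ` I" unfolding x by (auto intro: rev_image_eqI)
  qed
qed

text \<open>The candidates for the basis of a module: one representative of each class \<open>v\<^sub>i \<rat>\<^sup>*\<close>.\<close>

definition scaled :: "((nat \<Rightarrow> nat) \<Rightarrow> nat) \<Rightarrow> (nat \<Rightarrow> nat) \<Rightarrow> real" where
  "scaled w i = v i / real (w i)"

lemma scaled_pos: "w i > 0 \<Longrightarrow> scaled w i > 0"
  by (simp add: scaled_def v_pos)

lemma scaled_ratio_rational:
  assumes "i \<in> I" "j \<in> I" "w j > 0" "u i > 0" "scaled u i / scaled w j \<in> \<rat>"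
  shows "i = j"
proof -
  have "v i / v j = (scaled u i / scaled w j) * (real (u i) / real (w j))"
    using assms(3,4) by (simp add: scaled_def)
  also have "\<dots> \<in> \<rat>" by (rule Rats_mult[OF assms(5)]) simp
  finally show ?thesis using v_ratio_rational assms(1,2) by blast
qed

lemma scaled_independent:
  assumes w: "\<And>i. i \<in> I \<Longrightarrow> w i > 0"
  shows "rat_real.independent (scaled w ` I)"
proof (rule radicals_independent)
  show "\<exists>m>0. x ^ m \<in> \<rat>" if "x \<in> scaled w ` I" for x
  proof -
    obtain i where i: "x = scaled w i" using \<open>x \<in> scaled w ` I\<close> by blast
    have "v i ^ L \<in> \<rat>" unfolding v_power by (rule Rats_of_nat)
    then have "x ^ L \<in> \<rat>" unfolding i scaled_def power_divide by (intro Rats_divide) auto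
    then show ?thesis using L_pos by blast
  qed
  show "x * y \<in> rat_real.span (scaled w ` I)" if xy: "x \<in> scaled w ` I" "y \<in> scaled w ` I" for x y
  proof -
    obtain i j where ij: "i \<in> I" "j \<in> I" "x = scaled w i" "y = scaled w j" using xy by blast
    let ?q = "of_nat (carry i j * w (i \<oplus>\<^sub>I j)) / of_nat (w i * w j) :: rat"
    have "x * y = of_rat ?q * scaled w (i \<oplus>\<^sub>I j)"
      using ij w[OF plus_I, of i j] v_mult[of i j] by (simp add: scaled_def of_rat_divide of_rat_mult)
    also have "\<dots> \<in> rat_real.span (scaled w ` I)"
      using plus_I by (intro rat_real.span_scale rat_real.span_base imageI)
    finally show ?thesis .
  qed
  show "x / y \<notin> \<rat>" if "x \<in> scaled w ` I" "y \<in> scaled w ` I" "x \<noteq> y" for x y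
    using that scaled_ratio_rational[of _ _ w w] w by blast
qed (use finite_I scaled_pos w in auto)

lemma v_image_independent: "rat_real.independent (v ` I)"
proof -
  have "scaled (\<lambda>_. 1) = v" by (rule ext) (simp add: scaled_def)
  then show ?thesis using scaled_independent[of "\<lambda>_. 1"] by simp
qed

end

section \<open>The root ring as a \<open>\<int>\<^sub>+\<close>-ring\<close>

lemma a_inv_type_algebra: "\<ominus>\<^bsub>ring_of_type_algebra\<^esub> x = - (x :: real)"
proof -
  interpret K: cring "ring_of_type_algebra :: real ring" by (rule cring_from_type_algebra)
  show ?thesis by (rule K.minus_equality) (auto simp: ring_of_type_algebra_def)
qed

context coprime_radicals
begin

abbreviation R :: "real ring" where "R \<equiv> root_ring r d N"

lemma root_ring_simps [simp]:
  "x \<otimes>\<^bsub>R\<^esub> y = x * y" "x \<oplus>\<^bsub>R\<^esub> y = x + y" "\<one>\<^bsub>R\<^esub> = 1" "\<zero>\<^bsub>R\<^esub> = 0"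
  by (simp_all add: root_ring_def ring_of_type_algebra_def)

lemma v_mult_lattice: "a \<in> v ` I \<Longrightarrow> b \<in> v ` I \<Longrightarrow> a * b \<in> int_lattice (v ` I)"
proof clarify
  fix i j assume "i \<in> I" "j \<in> I"
  then have "v i * v j = of_int (int (carry i j)) * v (i \<oplus>\<^sub>I j)" by (simp add: v_mult)
  also have "\<dots> \<in> int_lattice (v ` I)"
    using finite_I plus_I by (intro int_lattice_scale int_lattice_base) auto
  finally show "v i * v j \<in> int_lattice (v ` I)" .
qed

lemma one_in_v: "1 \<in> v ` I" using v_zero zero_I by (metis imageI)

lemma generator_in_v:
  assumes "s \<in> {1..r}"
  shows "root (N s) (real (d s)) \<in> v ` I"
proof -
  let ?i = "\<lambda>t. if t = s then 1 else (0::nat)"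
  have "v ?i = (\<Prod>t=1..r. if t = s then root (N s) (real (d s)) else 1)"
    unfolding v_def by (rule prod.cong) auto
  also have "\<dots> = root (N s) (real (d s))" using assms by simp
  finally have "root (N s) (real (d s)) = v ?i" ..
  moreover have "?i \<in> I" using assms N_ge N_pos by (fastforce simp: I_def)
  ultimately show ?thesis by blast
qed

text \<open>The lattice is closed under multiplication because products of the \<open>v\<^sub>i\<close> are integer multiples of others.\<close>

lemma carrier_root_ring: "carrier R = int_lattice (v ` I)"
proof -
  let ?K = "ring_of_type_algebra :: real ring"
  let ?X = "(\<lambda>j. root (N j) (real (d j))) ` {1..r}"
  let ?G = "generate_ring ?K ?X"
  have ops: "x \<otimes>\<^bsub>?K\<^esub> y = x * y" "x \<oplus>\<^bsub>?K\<^esub> y = x + y" "\<one>\<^bsub>?K\<^esub> = 1" for x y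
    by (simp_all add: ring_of_type_algebra_def)
  have one: "1 \<in> ?G" using generate_ring.one[of ?K ?X] by (simp add: ops)
  have neg: "- x \<in> ?G" if "x \<in> ?G" for x
    using generate_ring.a_inv[OF that] by (simp add: a_inv_type_algebra)
  have add: "x + y \<in> ?G" if "x \<in> ?G" "y \<in> ?G" for x y
    using generate_ring.eng_add[OF that] by (simp add: ops)
  have mult: "x * y \<in> ?G" if "x \<in> ?G" "y \<in> ?G" for x y
    using generate_ring.eng_mult[OF that] by (simp add: ops)
  have zero: "0 \<in> ?G" using add[OF one neg[OF one]] by simp
  have nat: "of_nat n \<in> ?G" for n by (induction n) (use zero one add in auto)
  have int: "of_int n \<in> ?G" for n 
    using nat[of "nat n"] neg[OF nat[of "nat (- n)"]] by (cases "0 \<le> n") auto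
  have pow: "x ^ n \<in> ?G" if "x \<in> ?G" for x n by (induction n) (use one mult that in auto)
  have prod: "prod f S \<in> ?G" if "\<And>s. s \<in> S \<Longrightarrow> f s \<in> ?G" for f :: "nat \<Rightarrow> real" and S
    using that by (induction S rule: infinite_finite_induct) (use one mult in auto)
  have sum: "sum f S \<in> ?G" if "\<And>s. s \<in> S \<Longrightarrow> f s \<in> ?G" for f :: "real \<Rightarrow> real" and S
    using that by (induction S rule: infinite_finite_induct) (use zero add in auto)
  have "v i \<in> ?G" for i
    unfolding v_def by (intro prod pow generate_ring.incl) auto
  then have "int_lattice (v ` I) \<subseteq> ?G"
    unfolding int_lattice_def by (auto intro!: sum mult int simp del: One_nat_def)
  moreover have "x \<in> int_lattice (v ` I)" if "x \<in> ?G" for x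
    using that
  proof (induction rule: generate_ring.induct)
    case one
    then show ?case using one_in_v finite_I by (auto simp: ops intro: int_lattice_base)
  next
    case (incl h)
    then show ?case using generator_in_v finite_I by (auto intro!: int_lattice_base)
  next
    case (a_inv h)
    then show ?case by (simp add: a_inv_type_algebra int_lattice_minus)
  next
    case (eng_add x y)
    then show ?case by (simp add: ops int_lattice_add)
  next
    case (eng_mult x y)
    then show ?case using int_lattice_mult[OF v_mult_lattice] by (simp add: ops)
  qed
  ultimately show ?thesis by (auto simp: root_ring_def)
qed

lemma domain_root_ring: "domain R"
proof -
  interpret K: field "ring_of_type_algebra :: real ring" by (rule field_from_type_algebra)
  let ?X = "(\<lambda>j. root (N j) (real (d j))) ` {1..r}"
  have "subring (generate_ring ring_of_type_algebra ?X) ring_of_type_algebra"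
    by (rule K.generate_ring_is_subring) (simp add: ring_of_type_algebra_def)
  then show ?thesis
    unfolding root_ring_def
    using K.subdomainI' K.subdomain_iff by (simp add: K.generate_ring_incl ring_of_type_algebra_def)
qed

lemma add_pow_root_ring:
  assumes "x \<in> carrier R"
  shows "[(n::int)] \<cdot>\<^bsub>R\<^esub> x = of_int n * x"
proof -
  interpret domain R by (rule domain_root_ring)
  show ?thesis using additive_add_pow[of "\<lambda>x. x"] assms by simp
qed

lemma v_carrier: "v ` I \<subseteq> carrier R"
  using carrier_root_ring finite_I int_lattice_base by blast

lemma int_comb_root_ring: "int_comb R (v ` I) c = (\<Sum>a\<in>v ` I. of_int (c a) * a)"
proof -
  interpret domain R by (rule domain_root_ring)
  show ?thesis using additive_int_comb[of "\<lambda>x. x" "v ` I" c] finite_I v_carrier by simp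
qed

lemma zplus_root_ring: "zplus_ring R (root_basis r d N)"
  unfolding root_basis_eq
proof (intro zplus_ring.intro domain_root_ring zplus_ring_axioms.intro)
  interpret domain R by (rule domain_root_ring)
  show "int_basis R (v ` I)"
    unfolding int_basis_def
  proof (intro conjI allI impI ballI)
    show "int_span R (v ` I) = carrier R"
      unfolding int_span_def carrier_root_ring int_lattice_def int_comb_root_ring[abs_def] by auto
    show "c b = 0" if "int_comb R (v ` I) c = \<zero>\<^bsub>R\<^esub>" "b \<in> v ` I" for c b
      using int_independent[OF v_image_independent _ _ that(2)] that finite_I by (simp add: int_comb_root_ring)
  qed (use finite_I v_carrier in auto)
  show "\<one>\<^bsub>R\<^esub> \<in> v ` I" using one_in_v by simp
  show "x \<otimes>\<^bsub>R\<^esub> y \<in> nonneg_span R (v ` I)" if "x \<in> v ` I" "y \<in> v ` I" for x y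
  proof -
    obtain i j where ij: "i \<in> I" "j \<in> I" "x = v i" "y = v j" using \<open>x \<in> v ` I\<close> \<open>y \<in> v ` I\<close> by blast
    have k: "v (i \<oplus>\<^sub>I j) \<in> v ` I" using plus_I by blast
    have "x \<otimes>\<^bsub>R\<^esub> y = of_int (int (carry i j)) * v (i \<oplus>\<^sub>I j)" using ij by (simp add: v_mult)
    also have "\<dots> = int_comb R (v ` I) (\<lambda>b. if b = v (i \<oplus>\<^sub>I j) then int (carry i j) else 0)"
      using k v_carrier finite_I by (subst int_comb_single) (auto simp: add_pow_root_ring)
    finally show ?thesis
      unfolding nonneg_span_def by (intro CollectI exI[of _ "\<lambda>b. if b = v (i \<oplus>\<^sub>I j) then int (carry i j) else 0"]) auto
  qed
qed

end

section \<open>Lattices in the reals as irreducible modules\<close>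

text \<open>The floors of all multiples of a real number determine it. This injection moves lattices in \<open>\<real>\<close> to the
  type \<open>nat \<Rightarrow> int\<close> that the classification asks for.\<close>

definition encode :: "real \<Rightarrow> nat \<Rightarrow> int" where
  "encode x = (\<lambda>n. \<lfloor>real n * x\<rfloor>)"

lemma inj_encode: "inj encode"
proof (rule injI, rule ccontr)
  have less: "encode x \<noteq> encode y" if xy: "x < y" for x y
  proof
    assume eq: "encode x = encode y"
    obtain n where n: "1 < real n * (y - x)"
      using ex_less_of_nat_mult[of "y - x" 1] xy by auto
    then have "real n * x + 1 < real n * y" by (simp add: algebra_simps)
    then have "\<lfloor>real n * x\<rfloor> < \<lfloor>real n * y\<rfloor>" by linarith
    then show False using fun_cong[OF eq, of n] by (simp add: encode_def)
  qed
  fix x y :: real assume "encode x = encode y" "x \<noteq> y"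
  then show False using less[of x y] less[of y x] by (cases "x < y") auto
qed

definition decode :: "(nat \<Rightarrow> int) \<Rightarrow> real" where "decode = the_inv encode"

lemma decode_encode [simp]: "decode (encode x) = x"
  unfolding decode_def by (rule the_inv_f_f[OF inj_encode])

lemma encode_eq_iff [simp]: "encode x = encode y \<longleftrightarrow> x = y"
  using inj_encode by (auto dest: injD)

text \<open>The lattice spanned by \<open>U\<close>, transported along \<open>encode\<close>, on which real numbers act by multiplication.
  The multiplicative part of the record has no meaning and is filled with an arbitrary element.\<close>

definition lattice_module :: "real set \<Rightarrow> (real, nat \<Rightarrow> int) module" where
  "lattice_module U = \<lparr>carrier = encode ` int_lattice U, monoid.mult = (\<lambda>x y. encode 0), one = encode 0,
    ring.zero = encode 0, add = (\<lambda>x y. encode (decode x + decode y)), module.smult = (\<lambda>a x. encode (a * decode x))\<rparr>"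

lemma lattice_module_simps [simp]:
  "carrier (lattice_module U) = encode ` int_lattice U"
  "\<zero>\<^bsub>lattice_module U\<^esub> = encode 0"
  "x \<oplus>\<^bsub>lattice_module U\<^esub> y = encode (decode x + decode y)"
  "a \<odot>\<^bsub>lattice_module U\<^esub> x = encode (a * decode x)"
  by (simp_all add: lattice_module_def)

lemma abelian_group_lattice_module: "abelian_group (lattice_module U)"
proof (rule abelian_groupI)
  fix x assume "x \<in> carrier (lattice_module U)"
  then obtain a where "x = encode a" "a \<in> int_lattice U" by auto
  then show "\<exists>y\<in>carrier (lattice_module U). y \<oplus>\<^bsub>lattice_module U\<^esub> x = \<zero>\<^bsub>lattice_module U\<^esub>"
    using int_lattice_minus by (intro bexI[of _ "encode (- a)"]) auto
qed (auto simp: int_lattice_0 int_lattice_add add_ac)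

lemma int_comb_lattice_module:
  assumes "finite S" "S \<subseteq> int_lattice U"
  shows "int_comb (lattice_module U) (encode ` S) c = encode (\<Sum>u\<in>S. of_int (c (encode u)) * u)"
proof -
  interpret abelian_group "lattice_module U" by (rule abelian_group_lattice_module)
  have sub: "encode ` S \<subseteq> carrier (lattice_module U)" using assms(2) by auto
  have "decode (int_comb (lattice_module U) (encode ` S) c) = (\<Sum>b\<in>encode ` S. of_int (c b) * decode b)"
    using assms(1) sub by (intro additive_int_comb) auto
  also have "\<dots> = (\<Sum>u\<in>S. of_int (c (encode u)) * u)"
    by (subst sum.reindex) (auto simp: inj_on_def)
  finally have "encode (decode (int_comb (lattice_module U) (encode ` S) c)) = encode (\<Sum>u\<in>S. of_int (c (encode u)) * u)"
    by simp
  moreover have "int_comb (lattice_module U) (encode ` S) c \<in> encode ` int_lattice U"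
    using int_comb_closed[OF sub] by simp
  ultimately show ?thesis by (metis decode_encode imageE)
qed

lemma int_basis_lattice_module:
  assumes "finite U" "rat_real.independent U"
  shows "int_basis (lattice_module U) (encode ` U)"
  unfolding int_basis_def
proof (intro conjI allI impI ballI)
  have U: "U \<subseteq> int_lattice U" using int_lattice_base[OF assms(1)] by blast
  note comb = int_comb_lattice_module[OF assms(1) U]
  show "encode ` U \<subseteq> carrier (lattice_module U)" using U by auto
  have "int_span (lattice_module U) (encode ` U) = range (\<lambda>c. encode (\<Sum>u\<in>U. of_int (c (encode u)) * u))"
    unfolding int_span_def comb[abs_def] ..
  also have "\<dots> = encode ` int_lattice U"
  proof (intro equalityI subsetI)
    fix x assume "x \<in> encode ` int_lattice U"
    then obtain c where "x = encode (\<Sum>u\<in>U. of_int (c u) * u)" by (auto simp: int_lattice_def)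
    then have "x = encode (\<Sum>u\<in>U. of_int ((c \<circ> decode) (encode u)) * u)" by simp
    then show "x \<in> range (\<lambda>c. encode (\<Sum>u\<in>U. of_int (c (encode u)) * u))" by blast
  next
    fix x assume "x \<in> range (\<lambda>c. encode (\<Sum>u\<in>U. of_int (c (encode u)) * u))"
    then obtain c where "x = encode (\<Sum>u\<in>U. of_int (c (encode u)) * u)" by blast
    then show "x \<in> encode ` int_lattice U" by (simp add: int_latticeI)
  qed
  finally show "int_span (lattice_module U) (encode ` U) = carrier (lattice_module U)" by simp
  show "c b = 0"
    if cb: "int_comb (lattice_module U) (encode ` U) c = \<zero>\<^bsub>lattice_module U\<^esub>" "b \<in> encode ` U" for c b
  proof -
    obtain u where u: "u \<in> U" "b = encode u" using cb(2) by blast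
    have "(\<Sum>u\<in>U. of_int (c (encode u)) * u) = 0" using cb(1) by (simp add: comb)
    from int_independent[OF assms(2,1) this u(1)] show ?thesis using u(2) by simp
  qed
qed (use assms in auto)

context coprime_radicals
begin

text \<open>The condition under which the lattice with basis \<open>v\<^sub>i / w\<^sub>i\<close> is stable under the root ring with nonnegative
  coefficients, see \<open>cocycle_action\<close>.\<close>

definition cocycle :: "((nat \<Rightarrow> nat) \<Rightarrow> nat) \<Rightarrow> bool" where
  "cocycle w \<longleftrightarrow> (\<forall>i\<in>I. w i > 0) \<and> (\<forall>i\<in>I. \<forall>j\<in>I. w j dvd carry i j * w (i \<oplus>\<^sub>I j))"

lemma v_mult_scaled:
  assumes w: "w j > 0" "w (i \<oplus>\<^sub>I j) > 0" and ij: "i \<in> I" "j \<in> I"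
    and n: "carry i j * w (i \<oplus>\<^sub>I j) = w j * n"
  shows "v i * scaled w j = of_nat n * scaled w (i \<oplus>\<^sub>I j)"
proof -
  have "real (carry i j) * real (w (i \<oplus>\<^sub>I j)) = real (w j) * real n"
    using n by (metis of_nat_mult)
  then show ?thesis using v_mult[OF ij] w by (simp add: scaled_def field_simps)
qed

lemma cocycle_action:
  assumes "cocycle w" "i \<in> I" "j \<in> I"
  shows "\<exists>n>0. v i * scaled w j = of_nat n * scaled w (i \<oplus>\<^sub>I j)"
proof -
  obtain n where n: "carry i j * w (i \<oplus>\<^sub>I j) = w j * n"
    using assms unfolding cocycle_def by (metis dvdE)
  have "carry i j * w (i \<oplus>\<^sub>I j) > 0" using assms plus_I carry_pos by (auto simp: cocycle_def)
  then have "n > 0" unfolding n by simp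
  moreover have "v i * scaled w j = of_nat n * scaled w (i \<oplus>\<^sub>I j)"
    using assms plus_I by (intro v_mult_scaled n) (auto simp: cocycle_def)
  ultimately show ?thesis by blast
qed

lemma module_lattice_module:
  assumes "cocycle w"
  shows "module R (lattice_module (scaled w ` I))"
proof (rule moduleI)
  let ?U = "scaled w ` I"
  show "cring R" using domain_root_ring by (simp add: domain_def)
  show "abelian_group (lattice_module ?U)" by (rule abelian_group_lattice_module)
  have act: "a * u \<in> int_lattice ?U" if au: "a \<in> v ` I" "u \<in> ?U" for a u
  proof -
    obtain i j where ij: "i \<in> I" "j \<in> I" "a = v i" "u = scaled w j" using au by blast
    obtain n :: nat where "v i * scaled w j = of_nat n * scaled w (i \<oplus>\<^sub>I j)"
      using cocycle_action[OF assms ij(1,2)] by blast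
    then have "a * u = of_int (int n) * scaled w (i \<oplus>\<^sub>I j)" using ij by simp
    also have "\<dots> \<in> int_lattice ?U"
      using finite_I plus_I by (intro int_lattice_scale int_lattice_base) auto
    finally show ?thesis .
  qed
  show "a \<odot>\<^bsub>lattice_module ?U\<^esub> x \<in> carrier (lattice_module ?U)"
    if "a \<in> carrier R" "x \<in> carrier (lattice_module ?U)" for a x
    using that int_lattice_mult[OF act] by (auto simp: carrier_root_ring)
qed (auto simp: algebra_simps)

text \<open>Any basis element is carried to a positive multiple of any other one by some \<open>v\<^sub>k\<close>. So a nonzero submodule
  spanned by basis elements contains multiples of all of them and, being spanned by a subset of an independent set, the
  elements themselves.\<close>

lemma irreducible_lattice_module:
  assumes w: "cocycle w"
  shows "irreducible_zplus_module R (root_basis r d N) (lattice_module (scaled w ` I)) (encode ` scaled w ` I)"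
  unfolding irreducible_zplus_module_def
proof (intro conjI allI impI)
  let ?U = "scaled w ` I"
  let ?M = "lattice_module ?U"
  have fin: "finite ?U" using finite_I by simp
  have ind: "rat_real.independent ?U" using w by (intro scaled_independent) (auto simp: cocycle_def)
  have sub: "?U \<subseteq> int_lattice ?U" using int_lattice_base[OF fin] by blast
  note comb = int_comb_lattice_module[OF fin sub]
  interpret zplus_ring R "v ` I" using zplus_root_ring root_basis_eq by simp
  interpret M: module R ?M by (rule module_lattice_module[OF w])
  show "zplus_module R (root_basis r d N) ?M (encode ` ?U)"
    unfolding root_basis_eq
  proof unfold_locales
    show "int_basis ?M (encode ` ?U)" by (rule int_basis_lattice_module[OF fin ind])
    show "encode ` ?U \<noteq> {}" using zero_I by blast
    show "x \<odot>\<^bsub>?M\<^esub> m \<in> nonneg_span ?M (encode ` ?U)" if xm: "x \<in> v ` I" "m \<in> encode ` ?U" for x m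
    proof -
      obtain i j where ij: "i \<in> I" "j \<in> I" "x = v i" "m = encode (scaled w j)" using xm by blast
      obtain n where n: "v i * scaled w j = of_nat n * scaled w (i \<oplus>\<^sub>I j)"
        using cocycle_action[OF w ij(1,2)] by blast
      let ?k = "scaled w (i \<oplus>\<^sub>I j)"
      let ?c = "\<lambda>b. if b = encode ?k then int n else 0"
      have k: "?k \<in> ?U" using plus_I by blast
      have "(\<Sum>u\<in>?U. of_int (?c (encode u)) * u) = (\<Sum>u\<in>?U. if u = ?k then of_nat n * ?k else 0)"
        by (rule sum.cong) auto
      also have "\<dots> = v i * scaled w j" using fin k n by (simp only: sum.delta if_True)
      finally have "x \<odot>\<^bsub>?M\<^esub> m = int_comb ?M (encode ` ?U) ?c" using ij by (simp only: comb lattice_module_simps decode_encode)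
      then show ?thesis unfolding nonneg_span_def by (intro CollectI exI[of _ ?c]) auto
    qed
  qed
  fix H assume "zplus_submodule H R ?M (encode ` ?U)"
  then obtain S where H: "submodule H R ?M" and S: "S \<subseteq> encode ` ?U" "H = int_span ?M S"
    by (auto simp: zplus_submodule_def)
  obtain T where T: "T \<subseteq> ?U" "S = encode ` T" using S(1) by (meson subset_imageE)
  have finT: "finite T" using T fin finite_subset by blast
  have combT: "int_comb ?M S c = encode (\<Sum>u\<in>T. of_int (c (encode u)) * u)" for c
    unfolding T(2) using int_comb_lattice_module[OF finT] T(1) sub by blast
  show "H = {\<zero>\<^bsub>?M\<^esub>} \<or> H = carrier ?M"
  proof (cases "T = {}")
    case True
    then have "H = {\<zero>\<^bsub>?M\<^esub>}" unfolding S(2) int_span_def combT[abs_def] by auto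
    then show ?thesis ..
  next
    case False
    then obtain i where i: "i \<in> I" "scaled w i \<in> T" using T(1) by blast
    have "int_comb ?M S (\<lambda>b. if b = encode (scaled w i) then 1 else 0) = encode (scaled w i)"
    proof -
      have "(\<Sum>u\<in>T. of_int (if encode u = encode (scaled w i) then 1 else 0) * u) =
          (\<Sum>u\<in>T. if u = scaled w i then scaled w i else 0)"
        by (rule sum.cong) auto
      then show ?thesis unfolding combT using finT i(2) by simp
    qed
    then have iH: "encode (scaled w i) \<in> H" unfolding S(2) int_span_def by (metis rangeI)
    have "scaled w j \<in> T" if j: "j \<in> I" for j
    proof (rule ccontr)
      assume nT: "scaled w j \<notin> T"
      obtain n where n: "n > 0" "v (j \<ominus>\<^sub>I i) * scaled w i = of_nat n * scaled w ((j \<ominus>\<^sub>I i) \<oplus>\<^sub>I i)"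
        using cocycle_action[OF w minus_I i(1)] by blast
      have "(j \<ominus>\<^sub>I i) \<oplus>\<^sub>I i = j" using plus_minus[OF j i(1)] by (simp add: plus_commute)
      then have "v (j \<ominus>\<^sub>I i) \<odot>\<^bsub>?M\<^esub> encode (scaled w i) = encode (of_nat n * scaled w j)" using n by simp
      moreover have "v (j \<ominus>\<^sub>I i) \<in> carrier R" using v_carrier minus_I by blast
      ultimately have "encode (of_nat n * scaled w j) \<in> H" using M.submoduleE(4)[OF H _ iH] by metis
      then obtain c where c: "of_nat n * scaled w j = (\<Sum>u\<in>T. of_int (c (encode u)) * u)"
        unfolding S(2) int_span_def combT[abs_def] by auto
      \<comment> \<open>Coefficients of the difference of the two expressions, a relation on the whole basis.\<close>
      define e where "e u = (if u \<in> T then c (encode u) else if u = scaled w j then - int n else 0)" for u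
      have jU: "scaled w j \<in> ?U" using j by blast
      have "(\<Sum>u\<in>?U. of_int (e u) * u) =
          (\<Sum>u\<in>?U. (if u \<in> T then of_int (c (encode u)) * u else 0) - (if u = scaled w j then of_nat n * scaled w j else 0))"
        using nT by (intro sum.cong) (auto simp: e_def)
      also have "\<dots> = (\<Sum>u\<in>T. of_int (c (encode u)) * u) - of_nat n * scaled w j"
        using fin jU T(1) by (simp add: sum_subtractf sum.If_cases Int_absorb1)
      finally have "(\<Sum>u\<in>?U. of_int (e u) * u) = 0" using c by simp
      from int_independent[OF ind fin this jU] show False using nT n(1) by (simp add: e_def)
    qed
    then have "T = ?U" using T(1) by blast
    then have "H = carrier ?M"
      using int_basis_lattice_module[OF fin ind] T(2) S(2) by (simp add: int_basis_def)
    then show ?thesis ..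
  qed
qed

text \<open>An isomorphism is multiplication by the image \<open>v\<^sub>j / w'\<^sub>j\<close> of \<open>1\<close>. It must match the class of
  \<open>v\<^sub>i\<close> with that of \<open>v\<^sub>i v\<^sub>j\<close>, which gives the identity between the denominators.\<close>

lemma isomorphic_lattice_modulesD:
  assumes w: "\<And>i. i \<in> I \<Longrightarrow> w i > 0" "w (\<lambda>_. 0) = 1" and w': "\<And>i. i \<in> I \<Longrightarrow> w' i > 0"
    and iso: "zplus_isomorphic R (lattice_module (scaled w ` I)) (encode ` scaled w ` I)
      (lattice_module (scaled w' ` I)) (encode ` scaled w' ` I)"
  shows "\<exists>j\<in>I. \<forall>i\<in>I. carry i j * w' (i \<oplus>\<^sub>I j) = w' j * w i"
proof -
  let ?U = "scaled w ` I" and ?U' = "scaled w' ` I"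
  obtain \<psi> where \<psi>: "\<psi> \<in> module_homs R (lattice_module ?U) (lattice_module ?U')"
      and bij: "bij_betw \<psi> (encode ` ?U) (encode ` ?U')"
    using iso unfolding zplus_isomorphic_def by blast
  have base: "encode (scaled w i) \<in> encode ` ?U" if "i \<in> I" for i using that by blast
  have carr: "encode (scaled w i) \<in> carrier (lattice_module ?U)" if "i \<in> I" for i
    using that finite_I int_lattice_base[of ?U] by auto
  have smult: "\<psi> (encode (a * scaled w i)) = encode (a * decode (\<psi> (encode (scaled w i))))"
    if "a \<in> carrier R" "i \<in> I" for a i
    using \<psi> that(1) carr[OF that(2)] unfolding module_homs_def by auto
  have im: "\<exists>j\<in>I. \<psi> (encode (scaled w i)) = encode (scaled w' j)" if "i \<in> I" for i
    using bij_betwE[OF bij] base[OF that] by blast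
  obtain j where j: "j \<in> I" "\<psi> (encode (scaled w (\<lambda>_. 0))) = encode (scaled w' j)" using im[OF zero_I] by blast
  have "carry i j * w' (i \<oplus>\<^sub>I j) = w' j * w i" if i: "i \<in> I" for i
  proof -
    obtain k where k: "k \<in> I" "\<psi> (encode (scaled w i)) = encode (scaled w' k)" using im[OF i] by blast
    have "real (w i) \<in> carrier R"
      using int_lattice_scale[OF int_lattice_base[OF _ one_in_v], of "int (w i)"] finite_I
      by (simp add: carrier_root_ring)
    moreover have "v i \<in> carrier R" using v_carrier i by blast
    moreover have "real (w i) * scaled w i = v i * scaled w (\<lambda>_. 0)"
      using w i by (simp add: scaled_def v_zero)
    ultimately have "real (w i) * scaled w' k = v i * scaled w' j"
      using smult[of "real (w i)" i] smult[of "v i" "\<lambda>_. 0"] i zero_I j k by simp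
    then have eq: "real (w i) * v k * real (w' j) = real (carry i j) * v (i \<oplus>\<^sub>I j) * real (w' k)"
      using v_mult[OF i j(1)] w'[OF k(1)] w'[OF j(1)] by (simp add: scaled_def field_simps)
    have pos: "w i > 0" "w' j > 0" "w' k > 0" "v (i \<oplus>\<^sub>I j) > 0" using w w' i j k v_pos by auto
    then have "v k / v (i \<oplus>\<^sub>I j) = real (carry i j) * real (w' k) / (real (w i) * real (w' j))"
      using eq by (simp add: field_simps)
    also have "\<dots> \<in> \<rat>" by simp
    finally have "k = i \<oplus>\<^sub>I j" using v_ratio_rational[OF k(1) plus_I] by blast
    then have "real (w i) * real (w' j) = real (carry i j) * real (w' (i \<oplus>\<^sub>I j))"
      using eq pos by simp
    then have "w i * w' j = carry i j * w' (i \<oplus>\<^sub>I j)" by (metis of_nat_mult of_nat_eq_iff)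
    then show ?thesis by (simp add: mult.commute)
  qed
  with j(1) show ?thesis by blast
qed

end

section \<open>Thresholds of primes\<close>

lemma squarefree_multiplicity_le:
  fixes n p :: nat
  assumes "squarefree n" "normalization_semidom_class.prime p"
  shows "multiplicity p n \<le> 1"
proof -
  have "n \<noteq> 0" using assms(1) by (metis not_squarefree_0)
  from squarefree_factorial_semiring''[OF this] show ?thesis using assms by blast
qed

text \<open>Each prime occurs in \<open>a\<close> only once.\<close>

lemma squarefree_dvdI:
  fixes a b :: nat
  assumes "squarefree a" "b > 0" "\<And>p. normalization_semidom_class.prime p \<Longrightarrow> p dvd a \<Longrightarrow> p dvd b"
  shows "a dvd b"
proof (rule multiplicity_le_imp_dvd)
  show "a \<noteq> 0" using assms(1) by (metis not_squarefree_0)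
  fix p :: nat assume p: "normalization_semidom_class.prime p"
  show "multiplicity p a \<le> multiplicity p b"
  proof (cases "p dvd a")
    case True
    have "multiplicity p a \<le> 1" by (rule squarefree_multiplicity_le[OF assms(1) p])
    also have "1 \<le> multiplicity p b"
      using assms(2) assms(3)[OF p True] p by (simp add: Suc_le_eq prime_multiplicity_gt_zero_iff)
    finally show ?thesis .
  next
    case False
    then show ?thesis by (simp add: not_dvd_imp_multiplicity_0)
  qed
qed

context coprime_radicals
begin

definition prime_divs :: "nat \<Rightarrow> nat set" where "prime_divs s = prime_factors (d s)"

lemma prime_divs_prime: "p \<in> prime_divs s \<Longrightarrow> normalization_semidom_class.prime p" by (auto simp: prime_divs_def)

lemma prime_divs_unique:
  assumes "s \<in> {1..r}" "t \<in> {1..r}" "p \<in> prime_divs s" "p \<in> prime_divs t"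
  shows "s = t"
proof (rule ccontr)
  assume "s \<noteq> t"
  then have "multiplicity p (d t) = 0" using multiplicity_d[of s p t] assms by (simp add: prime_divs_def)
  moreover have "multiplicity p (d t) = 1" using multiplicity_d[of t p t] assms by (simp add: prime_divs_def)
  ultimately show False by simp
qed

lemma carry_squarefree: "squarefree (carry i j)"
  unfolding carry_def
proof (rule squarefree_prod_coprime)
  show "coprime (d a) (d b)"
    if "a \<in> {s \<in> {1..r}. N s \<le> i s + j s}" "b \<in> {s \<in> {1..r}. N s \<le> i s + j s}" "a \<noteq> b" for a b
    using d_coprime that unfolding pairwise_def by blast
qed (use d_squarefree in auto)

lemma dvd_carryD:
  assumes "normalization_semidom_class.prime p" "p dvd carry i j"
  shows "\<exists>s\<in>{1..r}. p \<in> prime_divs s \<and> N s \<le> i s + j s"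
proof -
  obtain s where "s \<in> {1..r}" "N s \<le> i s + j s" "p dvd d s"
    using assms unfolding carry_def by (subst (asm) prime_dvd_prod_iff) auto
  moreover have "p \<in> prime_divs s" using assms(1) d_pos[of s] calculation by (simp add: prime_divs_def in_prime_factors_iff)
  ultimately show ?thesis by blast
qed

lemma dvd_carry_iff:
  assumes "s \<in> {1..r}" "p \<in> prime_divs s"
  shows "p dvd carry i j \<longleftrightarrow> N s \<le> i s + j s"
proof
  assume "p dvd carry i j"
  then show "N s \<le> i s + j s" using dvd_carryD[OF prime_divs_prime[OF assms(2)]] prime_divs_unique assms by metis
next
  assume "N s \<le> i s + j s"
  moreover have "p dvd d s" using assms(2) by (auto simp: prime_divs_def)
  ultimately show "p dvd carry i j"
    unfolding carry_def using assms(1) by (intro dvd_trans[OF _ dvd_prodI[of _ s]]) auto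
qed

text \<open>A chosen prime of each \<open>d\<^sub>s\<close>, used to single out one base point.\<close>

definition pivot :: "nat \<Rightarrow> nat" where "pivot s = (SOME p. p \<in> prime_divs s)"

lemma pivot: "s \<in> {1..r} \<Longrightarrow> pivot s \<in> prime_divs s"
proof -
  assume s: "s \<in> {1..r}"
  obtain p where "normalization_semidom_class.prime p" "p dvd d s"
    using d_ge[OF s] prime_factor_nat[of "d s"] by auto
  then have "p \<in> prime_divs s" using d_pos[OF s] by (simp add: prime_divs_def in_prime_factors_iff)
  then show ?thesis unfolding pivot_def by (rule someI)
qed

text \<open>The primes whose thresholds remain free after normalization, tagged with the \<open>d\<^sub>s\<close> that they divide.\<close>

definition slots :: "(nat \<times> nat) set" where
  "slots = Sigma {1..r} (\<lambda>s. prime_divs s - {pivot s})"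

definition thresholds :: "(nat \<times> nat \<Rightarrow> nat) set" where
  "thresholds = (\<Pi>\<^sub>E x\<in>slots. {1..N (fst x)})"

text \<open>The denominators with prescribed thresholds; the pivots never divide them, which amounts to the threshold
  \<open>N\<^sub>s\<close>.\<close>

definition weight :: "(nat \<times> nat \<Rightarrow> nat) \<Rightarrow> (nat \<Rightarrow> nat) \<Rightarrow> nat" where
  "weight t i = (\<Prod>x\<in>{x\<in>slots. t x \<le> i (fst x)}. snd x)"

lemma finite_slots: "finite slots" unfolding slots_def prime_divs_def by (intro finite_SigmaI) auto

lemma finite_thresholds: "finite thresholds"
  unfolding thresholds_def by (intro finite_PiE finite_slots) auto

lemma card_thresholds: "card thresholds = (\<Prod>j=1..r. N j ^ (card (prime_factors (d j)) - 1))"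
proof -
  have "card thresholds = (\<Prod>x\<in>slots. N (fst x))"
    unfolding thresholds_def by (subst card_PiE[OF finite_slots]) simp
  also have "\<dots> = (\<Prod>s=1..r. \<Prod>p\<in>prime_divs s - {pivot s}. N s)"
    unfolding slots_def by (subst prod.Sigma) (auto simp: prime_divs_def split_def)
  also have "\<dots> = (\<Prod>s=1..r. N s ^ (card (prime_divs s) - 1))"
    using pivot by (intro prod.cong) (auto simp: card_Diff_singleton)
  finally show ?thesis by (simp add: prime_divs_def)
qed

lemma weight_pos: "weight t i > 0"
  unfolding weight_def by (intro prod_pos) (auto simp: slots_def prime_divs_def dest!: in_prime_factors_imp_prime prime_gt_0_nat)

lemma dvd_weightD:
  assumes "normalization_semidom_class.prime p" "p dvd weight t i"
  shows "\<exists>s. (s, p) \<in> slots \<and> t (s, p) \<le> i s"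
proof -
  obtain x where x: "x \<in> slots" "t x \<le> i (fst x)" "p dvd snd x"
    using assms finite_slots unfolding weight_def by (subst (asm) prime_dvd_prod_iff) auto
  have "normalization_semidom_class.prime (snd x)" using x(1) prime_divs_prime by (auto simp: slots_def)
  then have "p = snd x" using assms(1) x(3) primes_dvd_imp_eq by blast
  then show ?thesis using x by (intro exI[of _ "fst x"]) simp
qed

lemma dvd_weightI: "(s, p) \<in> slots \<Longrightarrow> t (s, p) \<le> i s \<Longrightarrow> p dvd weight t i"
  unfolding weight_def using finite_slots
  by (intro dvd_trans[OF _ dvd_prodI[of _ "(s, p)"]]) auto

lemma dvd_weight_iff:
  assumes "(s, p) \<in> slots"
  shows "p dvd weight t i \<longleftrightarrow> t (s, p) \<le> i s"
proof
  assume dv: "p dvd weight t i"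
  have p: "p \<in> prime_divs s" "s \<in> {1..r}" using assms by (auto simp: slots_def)
  obtain s' where s': "(s', p) \<in> slots" "t (s', p) \<le> i s'" using dvd_weightD[OF prime_divs_prime[OF p(1)] dv] by blast
  then have "s' = s" using prime_divs_unique p unfolding slots_def by blast
  then show "t (s, p) \<le> i s" using s' by simp
qed (use dvd_weightI assms in blast)

lemma pivot_not_dvd_weight:
  assumes "s \<in> {1..r}"
  shows "\<not> pivot s dvd weight t i"
proof
  assume "pivot s dvd weight t i"
  then obtain s' where s': "(s', pivot s) \<in> slots" using dvd_weightD prime_divs_prime pivot[OF assms] by blast
  then have "s' = s" using prime_divs_unique pivot[OF assms] assms unfolding slots_def by blast
  then show False using s' by (simp add: slots_def)
qed

lemma weight_squarefree: "squarefree (weight t i)"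
  unfolding weight_def
proof (rule squarefree_prod_coprime)
  fix a b assume ab: "a \<in> {x \<in> slots. t x \<le> i (fst x)}" "b \<in> {x \<in> slots. t x \<le> i (fst x)}" "a \<noteq> b"
  have "snd a \<noteq> snd b"
  proof
    assume eq: "snd a = snd b"
    then have "fst a = fst b" using ab(1,2) by (intro prime_divs_unique[of _ _ "snd a"]) (auto simp: slots_def)
    then show False using eq ab(3) by (simp add: prod_eq_iff)
  qed
  then show "coprime (snd a) (snd b)"
    using ab(1,2) prime_divs_prime by (intro primes_coprime) (auto simp: slots_def)
next
  fix a assume "a \<in> {x \<in> slots. t x \<le> i (fst x)}"
  then show "squarefree (snd a)" using prime_divs_prime by (intro squarefree_prime) (auto simp: slots_def)
qed

text \<open>If \<open>t\<^sub>p \<le> j\<^sub>s\<close>, then either \<open>i\<^sub>s + j\<^sub>s\<close> overflows and \<open>p\<close> divides the carry, or the sum is still at least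
  \<open>t\<^sub>p\<close>.\<close>

lemma cocycle_weight: "cocycle (weight t)"
  unfolding cocycle_def
proof (intro conjI ballI)
  fix i j assume ij: "i \<in> I" "j \<in> I"
  show "weight t j dvd carry i j * weight t (i \<oplus>\<^sub>I j)"
  proof (rule squarefree_dvdI[OF weight_squarefree])
    fix p :: nat assume p: "normalization_semidom_class.prime p" "p dvd weight t j"
    then obtain s where s: "(s, p) \<in> slots" "t (s, p) \<le> j s" using dvd_weightD by blast
    have sr: "s \<in> {1..r}" "p \<in> prime_divs s" using s(1) by (auto simp: slots_def)
    show "p dvd carry i j * weight t (i \<oplus>\<^sub>I j)"
    proof (cases "N s \<le> i s + j s")
      case True
      then show ?thesis using dvd_carry_iff[OF sr] by simp
    next
      case False
      then have "(i \<oplus>\<^sub>I j) s = i s + j s" using sr by (simp add: plus_def)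
      then have "p dvd weight t (i \<oplus>\<^sub>I j)" using s by (intro dvd_weightI) auto
      then show ?thesis by simp
    qed
  qed (simp add: carry_pos weight_pos)
qed (rule weight_pos)

lemma weight_zero:
  assumes "t \<in> thresholds"
  shows "weight t (\<lambda>_. 0) = 1"
  unfolding weight_def
proof (rule prod.neutral, rule ballI)
  fix x assume "x \<in> {x \<in> slots. t x \<le> 0}"
  moreover have "t x \<ge> 1" if "x \<in> slots" using assms that by (auto simp: thresholds_def PiE_iff)
  ultimately show "snd x = 1" by simp
qed

lemma weight_inj:
  assumes t: "t \<in> thresholds" and t': "t' \<in> thresholds" and eq: "\<And>i. i \<in> I \<Longrightarrow> weight t i = weight t' i"
  shows "t = t'"
proof (rule PiE_ext[OF t[unfolded thresholds_def] t'[unfolded thresholds_def]])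
  fix x assume x: "x \<in> slots"
  obtain s p where sp: "x = (s, p)" by fastforce
  have s: "s \<in> {1..r}" using x sp by (auto simp: slots_def)
  have "t x \<le> a \<longleftrightarrow> t' x \<le> a" if a: "a < N s" for a
  proof -
    define i where "i = (\<lambda>u. if u = s then a else (0::nat))"
    have "i \<in> I" using a s N_pos by (auto simp: I_def i_def)
    then show ?thesis
      using eq[of i] dvd_weight_iff[of s p t i] dvd_weight_iff[of s p t' i] x sp by (simp add: i_def)
  qed
  moreover have "t x \<le> N s" "t' x \<le> N s"
    using t t' x sp by (auto simp: thresholds_def PiE_iff)
  ultimately show "t x = t' x" by (metis le_antisym le_neq_implies_less order_refl)
qed

text \<open>The pivots divide neither weight, so the carries with the exponent \<open>j\<close> of the scaling factor cannot be
  divisible by a pivot. This forces \<open>j = 0\<close>, hence equal weights.\<close>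

lemma weight_modules_isomorphic_imp_eq:
  assumes t: "t \<in> thresholds" and t': "t' \<in> thresholds"
    and iso: "zplus_isomorphic R (lattice_module (scaled (weight t) ` I)) (encode ` scaled (weight t) ` I)
      (lattice_module (scaled (weight t') ` I)) (encode ` scaled (weight t') ` I)"
  shows "t = t'"
proof -
  obtain j where j: "j \<in> I" "\<forall>i\<in>I. carry i j * weight t' (i \<oplus>\<^sub>I j) = weight t' j * weight t i"
    using isomorphic_lattice_modulesD[OF _ weight_zero[OF t] _ iso] weight_pos by blast
  have "j s = 0" if s: "s \<in> {1..r}" for s
  proof (rule ccontr)
    assume j0: "j s \<noteq> 0"
    \<comment> \<open>The largest entry makes the addition of a nonzero \<open>j s\<close> overflow at \<open>s\<close>.\<close>
    define i where "i = (\<lambda>u. if u = s then N s - 1 else (0::nat))"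
    have i: "i \<in> I" using s N_pos by (auto simp: I_def i_def)
    have "pivot s dvd carry i j" using j0 s by (subst dvd_carry_iff[OF s pivot[OF s]]) (auto simp: i_def)
    then have "pivot s dvd weight t' j * weight t i" using j(2) i by (metis dvd_mult2)
    then show False
      using pivot_not_dvd_weight[OF s] prime_divs_prime[OF pivot[OF s]] by (simp add: prime_dvd_mult_iff)
  qed
  then have j0: "j = (\<lambda>_. 0)" using I_eqI[OF j(1) zero_I] by blast
  show ?thesis
  proof (rule weight_inj[OF t t'])
    fix i assume i: "i \<in> I"
    have "{s \<in> {1..r}. N s \<le> i s + 0} = {}" by (intro equals0I) (use I_less[OF i] in fastforce)
    then have "carry i (\<lambda>_. 0) = 1" by (simp only: carry_def prod.empty)
    then show "weight t i = weight t' i"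
      using bspec[OF j(2)[unfolded j0] i] weight_zero[OF t'] plus_zero[OF i] by simp
  qed
qed

text \<open>Taking \<open>i = -j\<close> in the divisibility shows that \<open>w\<^sub>j\<close> divides a carry, which is square-free. For a prime
  \<open>p\<close> of \<open>d\<^sub>s\<close>, the condition lets \<open>p\<close> pass from \<open>w\<^sub>i\<close> to \<open>w\<^bsub>i'\<^esub>\<close> whenever
  \<open>i\<^sub>s \<le> i'\<^sub>s\<close>, as the difference can then be added without overflow at \<open>s\<close>. So the set of
  \<open>i\<^sub>s\<close> with \<open>p\<close> dividing \<open>w\<^sub>i\<close> is an up-set, whose least element is the threshold.\<close>

lemma cocycle_thresholds:
  assumes w: "cocycle w" "w (\<lambda>_. 0) = 1"
  shows "\<exists>t. (\<forall>s\<in>{1..r}. \<forall>p\<in>prime_divs s. 1 \<le> t (s, p) \<and> t (s, p) \<le> N s \<and>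
      (\<forall>i\<in>I. p dvd w i \<longleftrightarrow> t (s, p) \<le> i s)) \<and>
    (\<forall>i\<in>I. squarefree (w i) \<and> (\<forall>p. normalization_semidom_class.prime p \<longrightarrow> p dvd w i \<longrightarrow> (\<exists>s\<in>{1..r}. p \<in> prime_divs s)))"
proof -
  have dvd_carry: "w i dvd carry ((\<lambda>_. 0) \<ominus>\<^sub>I i) i" if i: "i \<in> I" for i
  proof -
    have "((\<lambda>_. 0) \<ominus>\<^sub>I i) \<oplus>\<^sub>I i = (\<lambda>_. 0)" using plus_minus[OF zero_I i] by (simp add: plus_commute)
    then show ?thesis using w minus_I i unfolding cocycle_def by (metis mult.right_neutral)
  qed
  have pos: "i s \<noteq> 0" if "i \<in> I" "s \<in> {1..r}" "p \<in> prime_divs s" "p dvd w i" for i s p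
  proof
    assume i0: "i s = 0"
    have "p dvd carry ((\<lambda>_. 0) \<ominus>\<^sub>I i) i" using dvd_carry that dvd_trans by blast
    then have "N s \<le> ((\<lambda>_. 0) \<ominus>\<^sub>I i) s + i s" using dvd_carry_iff that by blast
    then show False using I_less[OF minus_I that(2), of "\<lambda>_. 0" i] i0 by simp
  qed
  have mono: "p dvd w i'" if "i \<in> I" "i' \<in> I" "s \<in> {1..r}" "p \<in> prime_divs s" "p dvd w i" "i s \<le> i' s" for i i' s p
  proof -
    have "(i' \<ominus>\<^sub>I i) \<oplus>\<^sub>I i = i'" using plus_minus[OF that(2,1)] by (simp add: plus_commute)
    then have "w i dvd carry (i' \<ominus>\<^sub>I i) i * w i'" using w minus_I that(1) unfolding cocycle_def by metis
    then have dv: "p dvd carry (i' \<ominus>\<^sub>I i) i * w i'" using that(5) dvd_trans by blast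
    have "i' s + (N s - i s) = (i' s - i s) + N s" using that(6) I_less[OF that(1,3)] by simp
    then have "(i' \<ominus>\<^sub>I i) s = (i' s - i s + N s) mod N s" using that(3) by (simp add: minus_def)
    also have "\<dots> = i' s - i s" using I_less[OF that(2,3)] by simp
    finally have "(i' \<ominus>\<^sub>I i) s + i s < N s" using that(6) I_less[OF that(2,3)] by simp
    then have "\<not> p dvd carry (i' \<ominus>\<^sub>I i) i" using dvd_carry_iff[OF that(3,4)] by simp
    then show ?thesis using dv prime_divs_prime[OF that(4)] by (simp add: prime_dvd_mult_iff)
  qed
  \<comment> \<open>The alternative \<open>a = N s\<close> covers primes that divide no \<open>w i\<close>.\<close>
  define t where "t = (\<lambda>(s, p). LEAST a. a = N s \<or> (\<exists>i\<in>I. i s = a \<and> p dvd w i))"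
  have "1 \<le> t (s, p) \<and> t (s, p) \<le> N s \<and> (\<forall>i\<in>I. p dvd w i \<longleftrightarrow> t (s, p) \<le> i s)"
    if s: "s \<in> {1..r}" and p: "p \<in> prime_divs s" for s p
  proof -
    let ?X = "\<lambda>a. a = N s \<or> (\<exists>i\<in>I. i s = a \<and> p dvd w i)"
    have t: "t (s, p) = (LEAST a. ?X a)" by (simp add: t_def)
    have X: "?X (t (s, p))" unfolding t by (rule LeastI[of ?X "N s"]) simp
    have le: "t (s, p) \<le> a" if "?X a" for a unfolding t using that by (rule Least_le)
    have "t (s, p) \<noteq> 0" using X pos[OF _ s p] N_pos[OF s] by fastforce
    moreover have "p dvd w i" if i: "i \<in> I" "t (s, p) \<le> i s" for i
    proof -
      have "t (s, p) \<noteq> N s" using i I_less[OF i(1) s] by simp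
      then obtain i' where "i' \<in> I" "i' s = t (s, p)" "p dvd w i'" using X by blast
      then show ?thesis using mono[OF _ i(1) s p] i(2) by simp
    qed
    ultimately show ?thesis using le by fastforce
  qed
  moreover have "squarefree (w i)" if "i \<in> I" for i
    using squarefree_mono[OF dvd_carry[OF that] carry_squarefree] .
  moreover have "\<exists>s\<in>{1..r}. p \<in> prime_divs s" if "i \<in> I" "normalization_semidom_class.prime p" "p dvd w i" for i p
    using dvd_carryD[OF that(2) dvd_trans[OF that(3) dvd_carry[OF that(1)]]] by blast
  ultimately show ?thesis by (intro exI[of _ t]) blast
qed

lemma normalized_cocycle_eq_weight:
  assumes w: "cocycle w" "w (\<lambda>_. 0) = 1" and pivot: "\<And>s i. s \<in> {1..r} \<Longrightarrow> i \<in> I \<Longrightarrow> \<not> pivot s dvd w i"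
  shows "\<exists>t\<in>thresholds. \<forall>i\<in>I. w i = weight t i"
proof -
  obtain t where t: "\<And>s p. s \<in> {1..r} \<Longrightarrow> p \<in> prime_divs s \<Longrightarrow> 1 \<le> t (s, p) \<and> t (s, p) \<le> N s \<and>
      (\<forall>i\<in>I. p dvd w i \<longleftrightarrow> t (s, p) \<le> i s)"
    and sf: "\<And>i. i \<in> I \<Longrightarrow> squarefree (w i)"
    and pr: "\<And>i p. i \<in> I \<Longrightarrow> normalization_semidom_class.prime p \<Longrightarrow> p dvd w i \<Longrightarrow> \<exists>s\<in>{1..r}. p \<in> prime_divs s"
    using cocycle_thresholds[OF w] by blast
  define t' where "t' = restrict t slots"
  have t': "t' (s, p) = t (s, p)" if "(s, p) \<in> slots" for s p using that by (simp add: t'_def)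
  have "t' \<in> thresholds"
    unfolding thresholds_def t'_def using t by (auto simp: slots_def)
  moreover have "w i = weight t' i" if i: "i \<in> I" for i
  proof (rule dvd_antisym)
    show "w i dvd weight t' i"
    proof (rule squarefree_dvdI[OF sf[OF i] weight_pos])
      fix p :: nat assume p: "normalization_semidom_class.prime p" "p dvd w i"
      then obtain s where s: "s \<in> {1..r}" "p \<in> prime_divs s" using pr i by blast
      then have "(s, p) \<in> slots" using pivot[OF s(1) i] p by (auto simp: slots_def)
      moreover have "t (s, p) \<le> i s" using t[OF s] i p by blast
      ultimately show "p dvd weight t' i" using t' by (intro dvd_weightI) auto
    qed
    show "weight t' i dvd w i"
    proof (rule squarefree_dvdI[OF weight_squarefree])
      show "w i > 0" using w i by (auto simp: cocycle_def)
      fix p :: nat assume "normalization_semidom_class.prime p" "p dvd weight t' i"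
      then obtain s where s: "(s, p) \<in> slots" "t' (s, p) \<le> i s" using dvd_weightD by blast
      then show "p dvd w i" using t[of s p] t' i by (auto simp: slots_def)
    qed
  qed
  ultimately show ?thesis by blast
qed

text \<open>Passing to the base point \<open>b\<^sub>j\<close> replaces \<open>w\<^sub>i\<close> by \<open>w'\<^sub>i = c(i,j) w\<^bsub>i+j\<^esub> / w\<^sub>j\<close>. If \<open>j\<^sub>s\<close> is the threshold
  of the pivot of \<open>d\<^sub>s\<close> modulo \<open>N\<^sub>s\<close>, then for this prime either only one of \<open>c(i,j)\<close> and \<open>w\<^bsub>i+j\<^esub>\<close> is divisible and
  \<open>w\<^sub>j\<close> cancels it, or (for the threshold \<open>N\<^sub>s\<close>) none of them is.\<close>

lemma exists_normalizing_shift: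
  assumes w: "cocycle w" "w (\<lambda>_. 0) = 1"
  shows "\<exists>j\<in>I. \<forall>w'. (\<forall>i\<in>I. w j * w' i = carry i j * w (i \<oplus>\<^sub>I j)) \<longrightarrow>
    (\<forall>s\<in>{1..r}. \<forall>i\<in>I. \<not> pivot s dvd w' i)"
proof -
  obtain t where t: "\<And>s p. s \<in> {1..r} \<Longrightarrow> p \<in> prime_divs s \<Longrightarrow> 1 \<le> t (s, p) \<and> t (s, p) \<le> N s \<and>
      (\<forall>i\<in>I. p dvd w i \<longleftrightarrow> t (s, p) \<le> i s)"
    and sf: "\<And>i. i \<in> I \<Longrightarrow> squarefree (w i)"
    using cocycle_thresholds[OF w] by blast
  \<comment> \<open>Reduction modulo \<open>N s\<close> matters only for the threshold \<open>N s\<close>, which becomes \<open>0\<close>.\<close>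
  define j where "j = (\<lambda>s. if s \<in> {1..r} then t (s, pivot s) mod N s else 0)"
  have j: "j \<in> I" using N_pos by (auto simp: j_def I_def)
  have "\<not> pivot s dvd w' i"
    if w': "\<forall>i\<in>I. w j * w' i = carry i j * w (i \<oplus>\<^sub>I j)" and s: "s \<in> {1..r}" and i: "i \<in> I" for w' s i
  proof
    let ?p = "pivot s" and ?\<tau> = "t (s, pivot s)" and ?k = "i \<oplus>\<^sub>I j"
    assume dv: "?p dvd w' i"
    note pP = pivot[OF s]
    have p: "normalization_semidom_class.prime ?p" using prime_divs_prime[OF pP] .
    have \<tau>: "1 \<le> ?\<tau>" "?\<tau> \<le> N s" and iff: "\<And>i. i \<in> I \<Longrightarrow> ?p dvd w i \<longleftrightarrow> ?\<tau> \<le> i s"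
      using t[OF s pP] by auto
    have eq: "w j * w' i = carry i j * w ?k" using w' i by blast
    have carry: "?p dvd carry i j \<longleftrightarrow> N s \<le> i s + j s" using dvd_carry_iff[OF s pP] .
    have i_less: "i s < N s" using I_less[OF i s] .
    have k: "?p dvd w ?k \<longleftrightarrow> ?\<tau> \<le> (i s + j s) mod N s" using iff[OF plus_I] s by (simp add: plus_def)
    show False
    proof (cases "?\<tau> = N s")
      case True
      then have "j s = 0" using s by (simp add: j_def)
      then have "\<not> ?p dvd carry i j" "\<not> ?p dvd w ?k" using carry k i_less True by auto
      moreover have "?p dvd carry i j * w ?k" using dv unfolding eq[symmetric] by simp
      ultimately show False using p by (simp add: prime_dvd_mult_iff)
    next
      case False
      then have js: "j s = ?\<tau>" using s \<tau> by (simp add: j_def)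
      \<comment> \<open>The pivot would divide the left-hand side of \<open>eq\<close> twice, hence both square-free factors on the right.\<close>
      have "?p dvd w j" using iff[OF j] js by simp
      then have "?p * ?p dvd carry i j * w ?k" using dv unfolding eq[symmetric] by (intro mult_dvd_mono)
      moreover have nz: "carry i j \<noteq> 0" "w ?k \<noteq> 0"
        using carry_pos[of i j] w plus_I by (auto simp: cocycle_def)
      ultimately have "2 \<le> multiplicity ?p (carry i j * w ?k)"
        using p by (intro multiplicity_geI) (auto simp: power2_eq_square)
      also have "\<dots> = multiplicity ?p (carry i j) + multiplicity ?p (w ?k)"
        using p nz by (intro prime_elem_multiplicity_mult_distrib) auto
      finally have "2 \<le> multiplicity ?p (carry i j) + multiplicity ?p (w ?k)" .
      moreover have "multiplicity ?p (carry i j) \<le> 1" "multiplicity ?p (w ?k) \<le> 1"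
        by (intro squarefree_multiplicity_le carry_squarefree sf plus_I p)+
      ultimately have "multiplicity ?p (carry i j) \<noteq> 0" "multiplicity ?p (w ?k) \<noteq> 0" by linarith+
      then have "?p dvd carry i j" "?p dvd w ?k" by (metis not_dvd_imp_multiplicity_0)+
      then have ge: "N s \<le> i s + ?\<tau>" "?\<tau> \<le> (i s + ?\<tau>) mod N s" using carry k js by auto
      have "(i s + ?\<tau>) mod N s = i s + ?\<tau> - N s"
        using ge(1) i_less \<tau>(2) False by (simp add: mod_if)
      then show False using ge i_less by simp
    qed
  qed
  with j show ?thesis by blast
qed

end

section \<open>Classification of the irreducible modules\<close>

context free_abelian
begin

lemma scaled_basis_eq:
  assumes "[(n::int)] \<cdot> b = [(m::int)] \<cdot> b'" "b \<in> B" "b' \<in> B" "n \<noteq> 0"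
  shows "b = b' \<and> n = m"
proof -
  have "n * coord G B b l = m * coord G B b' l" if "l \<in> B" for l
    using arg_cong[OF assms(1), of "\<lambda>x. coord G B x l"] that assms(2,3) basis_in_carrier
    by (simp add: coord_scale)
  from this[OF assms(2)] show ?thesis
    using assms(2-4) by (auto simp: coord_basis split: if_splits)
qed

lemma int_comb_subset:
  assumes "S \<subseteq> B"
  shows "int_comb G S c = int_comb G B (\<lambda>b. if b \<in> S then c b else 0)"
  unfolding int_comb_def
proof (rule add.finprod_mono_neutral_cong_left)
  show "finite B" by (rule finite_basis)
qed (use assms basis_carrier in \<open>auto simp: add_pow_def[of _ "0 :: int"]\<close>)

lemma int_span_subset_eq:
  assumes "S \<subseteq> B"
  shows "int_span G S = {x \<in> carrier G. \<forall>l\<in>B - S. coord G B x l = 0}"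
proof (intro equalityI subsetI)
  fix x assume "x \<in> int_span G S"
  then obtain c where x: "x = int_comb G B (\<lambda>b. if b \<in> S then c b else 0)"
    using int_comb_subset[OF assms] by (auto simp: int_span_def)
  then show "x \<in> {x \<in> carrier G. \<forall>l\<in>B - S. coord G B x l = 0}"
    using basis_carrier by (simp add: coord_int_comb)
next
  fix x assume x: "x \<in> {x \<in> carrier G. \<forall>l\<in>B - S. coord G B x l = 0}"
  then have "x = int_comb G B (coord G B x)" by (simp add: int_comb_coord)
  also have "\<dots> = int_comb G B (\<lambda>b. if b \<in> S then coord G B x b else 0)"
    using x by (intro int_comb_cong[OF _ basis_carrier]) auto
  also have "\<dots> = int_comb G S (coord G B x)" by (rule int_comb_subset[OF assms, symmetric])
  finally show "x \<in> int_span G S" unfolding int_span_def by (metis rangeI)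
qed

end

sublocale zplus_ring \<subseteq> ring_free: free_abelian R A
  by unfold_locales (rule ring_basis)

locale root_module = coprime_radicals r d N + zplus_module "root_ring r d N" "root_basis r d N" M B
  for r d N and M :: "(real, 'a) module" (structure) and B
begin

lemma v_in_carrier: "i \<in> I \<Longrightarrow> v i \<in> carrier R"
  using v_carrier by blast

lemma v_in_basis: "i \<in> I \<Longrightarrow> v i \<in> root_basis r d N"
  unfolding root_basis_eq by (rule imageI)

lemma v_v_smult:
  assumes "i \<in> I" "j \<in> I" "x \<in> carrier M"
  shows "v i \<odot> (v j \<odot> x) = [(int (carry i j))] \<cdot> (v (i \<oplus>\<^sub>I j) \<odot> x)"
proof -
  have "v i \<odot> (v j \<odot> x) = (v i * v j) \<odot> x"
    using smult_assoc1[of "v i" "v j" x] assms v_in_carrier by simp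
  also have "v i * v j = [(int (carry i j))] \<cdot>\<^bsub>R\<^esub> v (i \<oplus>\<^sub>I j)"
    using v_mult[OF assms(1,2)] by (simp add: add_pow_root_ring v_in_carrier plus_I)
  also have "\<dots> \<odot> x = [(int (carry i j))] \<cdot> (v (i \<oplus>\<^sub>I j) \<odot> x)"
    using assms(3) v_in_carrier[OF plus_I] by (intro smult_add_pow)
  finally show ?thesis .
qed

lemma exists_action:
  assumes i: "i \<in> I" and b: "b \<in> B"
  shows "\<exists>k\<in>B. \<exists>n>0. v i \<odot> b = [(int n)] \<cdot> k"
proof -
  let ?j = "(\<lambda>_. 0) \<ominus>\<^sub>I i"
  have "v i * v ?j = real (carry i ?j)"
    using v_mult[OF i minus_I] plus_minus[OF zero_I i] by (simp add: v_zero)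
  then have vv: "v i \<otimes>\<^bsub>R\<^esub> v ?j = [(int (carry i ?j))] \<cdot>\<^bsub>R\<^esub> \<one>\<^bsub>R\<^esub>"
    using add_pow_root_ring[of 1 "int (carry i ?j)"] one_in_v v_carrier by auto
  obtain k w where k: "k \<in> B" "w > 0" "v i \<odot> b = [(w::int)] \<cdot> k"
    using monomial_action[OF v_in_basis[OF i] v_in_basis[OF minus_I] vv _ b] carry_pos by auto
  then have "v i \<odot> b = [(int (nat w))] \<cdot> k" "nat w > 0" by auto
  with k(1) show ?thesis by blast
qed

text \<open>The action on basis elements: \<open>v\<^sub>i b\<close> is \<open>factor b i\<close> times the basis element \<open>shift i b\<close>.\<close>

definition shift :: "(nat \<Rightarrow> nat) \<Rightarrow> 'a \<Rightarrow> 'a" where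
  "shift i b = (SOME k. k \<in> B \<and> (\<exists>n>0. v i \<odot> b = [(int n)] \<cdot> k))"

definition factor :: "'a \<Rightarrow> (nat \<Rightarrow> nat) \<Rightarrow> nat" where
  "factor b i = (SOME n. n > 0 \<and> v i \<odot> b = [(int n)] \<cdot> shift i b)"

lemma action:
  assumes "i \<in> I" "b \<in> B"
  shows "shift i b \<in> B" "factor b i > 0" "v i \<odot> b = [(int (factor b i))] \<cdot> shift i b"
proof -
  have "\<exists>k. k \<in> B \<and> (\<exists>n>0. v i \<odot> b = [(int n)] \<cdot> k)" using exists_action[OF assms] by blast
  from someI_ex[OF this] have s: "shift i b \<in> B" "\<exists>n>0. v i \<odot> b = [(int n)] \<cdot> shift i b"
    unfolding shift_def by blast+
  then show "shift i b \<in> B" by blast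
  from someI_ex[OF s(2)] show "factor b i > 0" "v i \<odot> b = [(int (factor b i))] \<cdot> shift i b"
    unfolding factor_def by blast+
qed

text \<open>Both sides of \<open>v\<^sub>i (v\<^sub>j b) = c(i,j) (v\<^bsub>i+j\<^esub> b)\<close> are integer multiples of basis elements, which can be compared.
  Hence \<open>shift\<close> is a group action and \<open>factor b\<close> is a cocycle.\<close>

lemma shift_factor_plus:
  assumes "i \<in> I" "j \<in> I" "b \<in> B"
  shows "shift i (shift j b) = shift (i \<oplus>\<^sub>I j) b"
    and "factor b j * factor (shift j b) i = carry i j * factor b (i \<oplus>\<^sub>I j)"
proof -
  note aj = action[OF assms(2,3)]
  note ai = action[OF assms(1) aj(1)]
  note aij = action[OF plus_I assms(3), of i j]
  note carr = free.basis_in_carrier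
  have "[(int (factor b j * factor (shift j b) i))] \<cdot> shift i (shift j b) = v i \<odot> (v j \<odot> b)"
    using aj ai assms carr v_in_carrier by (simp add: smult_scale M.add.int_pow_pow mult.commute)
  also have "\<dots> = [(int (carry i j * factor b (i \<oplus>\<^sub>I j)))] \<cdot> shift (i \<oplus>\<^sub>I j) b"
    using v_v_smult[OF assms(1,2) carr[OF assms(3)]] aij carr
    by (simp add: M.add.int_pow_pow mult.commute)
  finally have "shift i (shift j b) = shift (i \<oplus>\<^sub>I j) b \<and>
      int (factor b j * factor (shift j b) i) = int (carry i j * factor b (i \<oplus>\<^sub>I j))"
    using ai aj aij by (intro free.scaled_basis_eq) auto
  then show "shift i (shift j b) = shift (i \<oplus>\<^sub>I j) b"
    "factor b j * factor (shift j b) i = carry i j * factor b (i \<oplus>\<^sub>I j)"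
    unfolding of_nat_eq_iff by blast+
qed

lemma shift_factor_zero:
  assumes "b \<in> B"
  shows "shift (\<lambda>_. 0) b = b" "factor b (\<lambda>_. 0) = 1"
proof -
  note a = action[OF zero_I assms]
  have "v (\<lambda>_. 0) \<odot> b = b" using smult_one free.basis_in_carrier[OF assms] by (simp add: v_zero)
  then have "[(int (factor b (\<lambda>_. 0)))] \<cdot> shift (\<lambda>_. 0) b = [(1::int)] \<cdot> b"
    using a free.basis_in_carrier[OF assms] by simp
  then have "shift (\<lambda>_. 0) b = b \<and> int (factor b (\<lambda>_. 0)) = 1"
    using a assms by (intro free.scaled_basis_eq) auto
  then show "shift (\<lambda>_. 0) b = b" "factor b (\<lambda>_. 0) = 1" by auto
qed

lemma cocycle_factor: "b \<in> B \<Longrightarrow> cocycle (factor b)"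
  unfolding cocycle_def using action(2) shift_factor_plus(2) by (metis dvd_triv_left)

lemma power_smult_eq:
  assumes "x \<in> carrier R" "y \<in> carrier R" "b \<in> carrier M" "x \<odot> b = y \<odot> b"
  shows "x ^ n \<in> carrier R \<and> y ^ n \<in> carrier R \<and> x ^ n \<odot> b = y ^ n \<odot> b"
proof (induction n)
  case 0
  then show ?case using one_in_v v_carrier by auto
next
  case (Suc n)
  have xn: "x ^ Suc n \<in> carrier R" and yn: "y ^ Suc n \<in> carrier R"
    using m_closed[of x "x ^ n"] m_closed[of y "y ^ n"] Suc assms by auto
  have "x ^ Suc n \<odot> b = x \<odot> (y ^ n \<odot> b)"
    using smult_assoc1[of x "x ^ n" b] Suc assms by simp
  also have "\<dots> = y ^ n \<odot> (x \<odot> b)"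
    using smult_assoc1[of x "y ^ n" b] smult_assoc1[of "y ^ n" x b] Suc assms by (simp add: mult.commute)
  also have "\<dots> = y ^ Suc n \<odot> b"
    using smult_assoc1[of "y ^ n" y b] Suc assms by (simp add: mult.commute)
  finally show ?case using xn yn by blast
qed

text \<open>If \<open>v\<^sub>i b\<close> and \<open>v\<^sub>j b\<close> are proportional, then two elements \<open>x\<close> and \<open>y\<close> of the ring agree on \<open>b\<close>, and so do
  their \<open>L\<close>-th powers, which are positive integers. As \<open>M\<close> is torsion-free, \<open>x = y\<close>, which makes
  \<open>v\<^sub>i / v\<^sub>j\<close> rational.\<close>

lemma shift_inj:
  assumes ij: "i \<in> I" "j \<in> I" and b: "b \<in> B" and eq: "shift i b = shift j b"
  shows "i = j"
proof -
  note ai = action[OF ij(1) b] and aj = action[OF ij(2) b]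
  note carr = free.basis_in_carrier
  let ?x = "real (factor b j) * v i" and ?y = "real (factor b i) * v j"
  have x: "?x = [(int (factor b j))] \<cdot>\<^bsub>R\<^esub> v i" and y: "?y = [(int (factor b i))] \<cdot>\<^bsub>R\<^esub> v j"
    using ij by (simp_all add: add_pow_root_ring v_in_carrier)
  have mult_closed: "real n * v i \<in> carrier R" if "i \<in> I" for n i
    using int_lattice_scale[of "v i" "v ` I" "int n"] v_in_carrier[OF that] by (simp add: carrier_root_ring)
  have xR: "?x \<in> carrier R" and yR: "?y \<in> carrier R" using mult_closed ij by auto
  have "?x \<odot> b = [(int (factor b j))] \<cdot> (v i \<odot> b)"
    unfolding x using v_in_carrier ij b carr by (intro smult_add_pow)
  also have "\<dots> = [(int (factor b i))] \<cdot> (v j \<odot> b)"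
    using ai aj eq carr by (simp add: M.add.int_pow_pow mult.commute)
  also have "\<dots> = ?y \<odot> b"
    unfolding y using v_in_carrier ij b carr by (intro smult_add_pow[symmetric])
  finally have "?x \<odot> b = ?y \<odot> b" .
  from power_smult_eq[OF xR yR carr[OF b] this, of L]
  have L: "?x ^ L \<odot> b = ?y ^ L \<odot> b" by blast
  have int_smult: "of_int n \<odot> b = [n] \<cdot> b" for n
  proof -
    have one: "1 \<in> carrier R" using one_in_v v_carrier by blast
    have "of_int n \<odot> b = ([n] \<cdot>\<^bsub>R\<^esub> 1) \<odot> b" by (simp add: add_pow_root_ring[OF one])
    also have "\<dots> = [n] \<cdot> (1 \<odot> b)" by (rule smult_add_pow[OF one carr[OF b]])
    also have "1 \<odot> b = b" using smult_one[OF carr[OF b]] by simp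
    finally show ?thesis .
  qed
  have int_pow: "\<exists>n :: int. n > 0 \<and> (real c * v i) ^ L = of_int n" if "c > 0" for c i
  proof -
    define K where "K = (\<Prod>s=1..r. d s ^ (i s * (L div N s)))"
    have "K > 0" unfolding K_def using d_pos by (intro prod_pos) auto
    then have "int (c ^ L * K) > 0" using that by simp
    moreover have "(real c * v i) ^ L = of_int (int (c ^ L * K))"
      unfolding power_mult_distrib v_power K_def by simp
    ultimately show ?thesis by (intro exI conjI)
  qed
  from int_pow[OF aj(2), of i] obtain n :: int where n: "n > 0" "?x ^ L = of_int n" by (elim exE conjE)
  from int_pow[OF ai(2), of j] obtain m :: int where m: "m > 0" "?y ^ L = of_int m" by (elim exE conjE)
  have nm: "[n] \<cdot> b = [m] \<cdot> b" using L unfolding n(2) m(2) int_smult .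
  have "n = m" by (rule conjunct2[OF free.scaled_basis_eq[OF nm b b]]) (use n(1) in simp)
  then have "?x ^ L = ?y ^ L" unfolding n(2) m(2) by simp
  moreover have "?x \<ge> 0" "?y \<ge> 0" using less_imp_le[OF v_pos] by simp_all
  ultimately have "?x = ?y" by (rule power_eq_imp_eq_base[OF _ _ _ L_pos])
  then have "v i / v j = real (factor b i) / real (factor b j)"
    using aj(2) v_pos[of j] by (simp add: field_simps)
  also have "\<dots> \<in> \<rat>" by simp
  finally show ?thesis by (rule v_ratio_rational[OF ij])
qed

text \<open>Since \<open>shift\<close> is a group action, each \<open>v\<^sub>i\<close> maps orbit elements to multiples of orbit elements.\<close>

lemma orbit_submodule:
  assumes b: "b \<in> B"
  shows "zplus_submodule (int_span M ((\<lambda>i. shift i b) ` I)) R M B"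
proof -
  let ?S = "(\<lambda>i. shift i b) ` I"
  have S: "?S \<subseteq> B" using action(1)[OF _ b] by blast
  note carr = free.basis_in_carrier
  have act: "coord M B (a \<odot> k) l = 0" if a: "a \<in> carrier R" and k: "k \<in> ?S" and l: "l \<in> B - ?S" for a k l
    using a
  proof (induction rule: ring_free.carrier_induct)
    case zero
    then show ?case using smult_l_null[of k] k S carr l by (auto simp: free.coord_zero)
  next
    case (basis x n)
    then obtain i where i: "i \<in> I" "x = v i" by (auto simp: root_basis_eq)
    obtain j where j: "j \<in> I" "k = shift j b" using k by blast
    have kB: "k \<in> B" using k S by blast
    note ai = action[OF i(1) kB]
    have "shift i k \<noteq> l" using shift_factor_plus(1)[OF i(1) j(1) b] j plus_I l by blast
    then have "coord M B (v i \<odot> k) l = 0"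
      using ai l carr by (simp add: free.coord_scale free.coord_basis)
    then show ?case
      using i kB carr v_in_carrier l by (simp add: smult_add_pow free.coord_scale)
  next
    case (add x y)
    have kM: "k \<in> carrier M" using k S carr by blast
    have "coord M B ((x \<oplus>\<^bsub>R\<^esub> y) \<odot> k) l = coord M B (x \<odot> k) l + coord M B (y \<odot> k) l"
      unfolding smult_l_distr[OF add(1,2) kM] using add(1,2) kM l by (intro free.coord_add) auto
    then show ?case using add by simp
  qed
  have "submodule (int_span M ?S) R M"
    unfolding free.int_span_subset_eq[OF S]
  proof (rule submoduleI)
    fix a x assume a: "a \<in> carrier R" and x: "x \<in> {x \<in> carrier M. \<forall>l\<in>B - ?S. coord M B x l = 0}"
    have "coord M B (a \<odot> x) l = 0" if l: "l \<in> B - ?S" for l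
    proof -
      have "coord M B (a \<odot> x) l = (\<Sum>k\<in>B. coord M B x k * coord M B (a \<odot> k) l)"
        using a x l by (intro coord_smult) auto
      also have "\<dots> = 0"
        using x act[OF a _ l] by (intro sum.neutral) auto
      finally show ?thesis .
    qed
    then show "a \<odot> x \<in> {x \<in> carrier M. \<forall>l\<in>B - ?S. coord M B x l = 0}" using a x by auto
  next
    fix x assume x: "x \<in> {x \<in> carrier M. \<forall>l\<in>B - ?S. coord M B x l = 0}"
    have "\<ominus> x = [(- 1 :: int)] \<cdot> x" using x by (simp add: M.add.int_pow_neg)
    then show "\<ominus> x \<in> {x \<in> carrier M. \<forall>l\<in>B - ?S. coord M B x l = 0}"
      using x by (auto simp: free.coord_scale simp del: M.add.int_pow_neg)
  qed (auto simp: free.coord_zero free.coord_add)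
  then show ?thesis unfolding zplus_submodule_def using S by blast
qed

lemma irreducible_imp_transitive:
  assumes irr: "irreducible_zplus_module R (root_basis r d N) M B" and b: "b \<in> B"
  shows "B = (\<lambda>i. shift i b) ` I"
proof (rule ccontr)
  let ?S = "(\<lambda>i. shift i b) ` I"
  have S: "?S \<subseteq> B" using action(1)[OF _ b] by blast
  note carr = free.basis_in_carrier
  assume "B \<noteq> ?S"
  then obtain k where k: "k \<in> B" "k \<notin> ?S" using S by blast
  have coord1: "coord M B l l = 1" if "l \<in> B" for l using that by (simp add: free.coord_basis)
  have bS: "b \<in> ?S" using shift_factor_zero(1)[OF b] zero_I by (metis image_eqI)
  then have "b \<in> int_span M ?S"
    unfolding free.int_span_subset_eq[OF S] using b carr by (auto simp: free.coord_basis)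
  moreover have "b \<noteq> \<zero>" using coord1[OF b] free.coord_zero[OF b] by auto
  ultimately have "int_span M ?S = carrier M"
    using irr orbit_submodule[OF b] unfolding irreducible_zplus_module_def by blast
  then have "k \<in> int_span M ?S" using carr k(1) by blast
  then have "coord M B k k = 0" unfolding free.int_span_subset_eq[OF S] using k by blast
  then show False using coord1[OF k(1)] by simp
qed

text \<open>The isomorphism sends the basis element \<open>shift i b\<close> to \<open>v\<^sub>i / w\<^sub>i\<close>, that is, it is the unique
  linear map into \<open>\<real>\<close> with \<open>b \<mapsto> 1\<close>.\<close>

lemma isomorphic_to_lattice_module:
  assumes orbit: "B = (\<lambda>i. shift i b) ` I" and b: "b \<in> B" and w: "\<And>i. i \<in> I \<Longrightarrow> factor b i = w i"
  shows "zplus_isomorphic R M B (lattice_module (scaled w ` I)) (encode ` scaled w ` I)"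
proof -
  let ?U = "scaled w ` I"
  note carr = free.basis_in_carrier
  have wpos: "w i > 0" if "i \<in> I" for i using action(2)[OF that b] w[OF that] by simp
  have inj: "inj_on (\<lambda>i. shift i b) I" using shift_inj[OF _ _ b] by (auto intro: inj_onI)
  define u where "u k = scaled w (the_inv_into I (\<lambda>i. shift i b) k)" for k
  have u: "u (shift i b) = scaled w i" if "i \<in> I" for i
    unfolding u_def by (simp add: the_inv_into_f_f[OF inj that])
  have u_act: "v i * u k = real (factor k i) * u (shift i k)" if i: "i \<in> I" and k: "k \<in> B" for i k
  proof -
    obtain j where j: "j \<in> I" "k = shift j b" using k orbit by blast
    have "w j * factor k i = carry i j * w (i \<oplus>\<^sub>I j)"
      using shift_factor_plus(2)[OF i j(1) b] j w plus_I by simp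
    then show ?thesis
      using v_mult_scaled[of w j i "factor k i"] wpos i j plus_I u shift_factor_plus(1)[OF i j(1) b] by simp
  qed
  define \<phi> where "\<phi> x = (\<Sum>k\<in>B. of_int (coord M B x k) * u k)" for x
  have \<phi>_add: "\<phi> (x \<oplus> y) = \<phi> x + \<phi> y" if "x \<in> carrier M" "y \<in> carrier M" for x y
    using that unfolding \<phi>_def by (simp add: free.coord_add distrib_right sum.distrib)
  note \<phi>_scale = M.additive_add_pow[of \<phi>, OF \<phi>_add] and \<phi>_zero = M.additive_zero[of \<phi>, OF \<phi>_add]
  have \<phi>_basis: "\<phi> k = u k" if "k \<in> B" for k
  proof -
    have "\<phi> k = (\<Sum>l\<in>B. if l = k then u k else 0)"
      unfolding \<phi>_def using that by (intro sum.cong) (auto simp: free.coord_basis)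
    then show ?thesis using that free.finite_basis by simp
  qed
  have \<phi>_v: "\<phi> (v i \<odot> x) = v i * \<phi> x" if i: "i \<in> I" and x: "x \<in> carrier M" for i x
    using x
  proof (induction rule: free.carrier_induct)
    case zero
    then show ?case using smult_r_null[OF v_in_carrier[OF i]] by (simp add: \<phi>_zero)
  next
    case (basis k n)
    note ai = action[OF i basis]
    have "\<phi> (v i \<odot> k) = v i * \<phi> k"
      using ai carr basis by (simp add: \<phi>_scale \<phi>_basis u_act[OF i basis])
    then show ?case
      using v_in_carrier[OF i] basis carr by (simp add: smult_scale \<phi>_scale)
  next
    case (add x y)
    then show ?case using v_in_carrier[OF i] by (simp add: smult_r_distr \<phi>_add distrib_left)
  qed
  have \<phi>_smult: "\<phi> (a \<odot> x) = a * \<phi> x" if a: "a \<in> carrier R" and x: "x \<in> carrier M" for a x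
    using a
  proof (induction rule: ring_free.carrier_induct)
    case zero
    then show ?case using smult_l_null[OF x] by (simp add: \<phi>_zero)
  next
    case (basis y n)
    then obtain i where i: "i \<in> I" "y = v i" by (auto simp: root_basis_eq)
    have "\<phi> (([n] \<cdot>\<^bsub>R\<^esub> v i) \<odot> x) = of_int n * (v i * \<phi> x)"
      using v_in_carrier[OF i(1)] x by (simp add: smult_add_pow \<phi>_scale \<phi>_v[OF i(1)])
    then show ?case using i v_in_carrier[OF i(1)] by (simp add: add_pow_root_ring)
  next
    case (add y z)
    then show ?case using smult_l_distr[of y z x] x by (simp add: \<phi>_add distrib_right)
  qed
  have U: "u k \<in> ?U" if "k \<in> B" for k
  proof -
    obtain i where "i \<in> I" "k = shift i b" using \<open>k \<in> B\<close> orbit by blast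
    then show ?thesis using u by simp
  qed
  have \<phi>_lattice: "\<phi> x \<in> int_lattice ?U" for x
    unfolding \<phi>_def using finite_I U by (intro int_lattice_sum int_lattice_scale int_lattice_base) auto
  have "(\<lambda>x. encode (\<phi> x)) \<in> module_homs R M (lattice_module ?U)"
    unfolding module_homs_def using \<phi>_lattice by (auto simp: \<phi>_add \<phi>_smult)
  moreover have "bij_betw (\<lambda>x. encode (\<phi> x)) B (encode ` ?U)"
    unfolding bij_betw_def
  proof
    have "(\<lambda>x. encode (\<phi> x)) ` B = (\<lambda>x. encode (u x)) ` B" using \<phi>_basis by simp
    also have "\<dots> = (\<lambda>i. encode (u (shift i b))) ` I" by (subst orbit) (simp add: image_image)
    also have "\<dots> = encode ` ?U" using u by (auto simp: image_image)
    finally show "(\<lambda>x. encode (\<phi> x)) ` B = encode ` ?U" .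
    show "inj_on (\<lambda>x. encode (\<phi> x)) B"
    proof (rule inj_onI)
      fix k l assume kl: "k \<in> B" "l \<in> B" "encode (\<phi> k) = encode (\<phi> l)"
      obtain i j where ij: "i \<in> I" "j \<in> I" "k = shift i b" "l = shift j b" using kl orbit by blast
      then have "scaled w i = scaled w j" using kl \<phi>_basis u by simp
      then have "scaled w i / scaled w j = 1" using scaled_pos wpos[OF ij(2)] by (simp add: less_imp_neq[symmetric])
      then have "i = j" using ij wpos by (intro scaled_ratio_rational[of i j w w]) auto
      then show "k = l" using ij by simp
    qed
  qed
  ultimately show ?thesis unfolding zplus_isomorphic_def by blast
qed

lemma irreducible_isomorphic_to_weight_module:
  assumes irr: "irreducible_zplus_module R (root_basis r d N) M B"
  shows "\<exists>t\<in>thresholds. zplus_isomorphic R M B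
    (lattice_module (scaled (weight t) ` I)) (encode ` scaled (weight t) ` I)"
proof -
  obtain b where b: "b \<in> B" using basis_nonempty by blast
  from exists_normalizing_shift[OF cocycle_factor[OF b] shift_factor_zero(2)[OF b]]
  obtain j where j: "j \<in> I" and norm: "\<forall>w'. (\<forall>i\<in>I. factor b j * w' i = carry i j * factor b (i \<oplus>\<^sub>I j)) \<longrightarrow>
      (\<forall>s\<in>{1..r}. \<forall>i\<in>I. \<not> pivot s dvd w' i)"
    by (elim bexE)
  let ?b = "shift j b"
  have b': "?b \<in> B" by (rule action(1)[OF j b])
  have "\<forall>s\<in>{1..r}. \<forall>i\<in>I. \<not> pivot s dvd factor ?b i"
    using shift_factor_plus(2)[OF _ j b] by (intro mp[OF spec[OF norm]] ballI)
  then obtain t where t: "t \<in> thresholds" "\<forall>i\<in>I. factor ?b i = weight t i"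
    using normalized_cocycle_eq_weight[OF cocycle_factor[OF b'] shift_factor_zero(2)[OF b']] by blast
  then show ?thesis
    using isomorphic_to_lattice_module[OF irreducible_imp_transitive[OF irr b'] b'] by blast
qed

end

theorem theorem3p15:
  fixes r :: nat and d N :: "nat \<Rightarrow> nat"
  assumes "\<And>j. j \<in> {1..r} \<Longrightarrow> 2 \<le> d j"
    and "\<And>j. j \<in> {1..r} \<Longrightarrow> squarefree (d j)"
    and "pairwise (\<lambda>i j. coprime (d i) (d j)) {1..r}"
    and "\<And>j. j \<in> {1..r} \<Longrightarrow> 2 \<le> N j"
  shows "\<exists>S :: ((real, nat \<Rightarrow> int) module \<times> (nat \<Rightarrow> int) set) set.
    finite S \<and>
    card S = (\<Prod>j=1..r. N j ^ (card (prime_factors (d j)) - 1)) \<and>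
    (\<forall>(M, B)\<in>S. irreducible_zplus_module (root_ring r d N) (root_basis r d N) M B) \<and>
    (\<forall>(M, B)\<in>S. \<forall>(M', B')\<in>S. zplus_isomorphic (root_ring r d N) M B M' B' \<longrightarrow> (M, B) = (M', B')) \<and>
    (\<forall>(M :: (real, 'm) module) B.
      irreducible_zplus_module (root_ring r d N) (root_basis r d N) M B \<longrightarrow>
      (\<exists>(M', B')\<in>S. zplus_isomorphic (root_ring r d N) M B M' B'))"
proof -
  interpret coprime_radicals r d N by unfold_locales (use assms in auto)
  define F where "F t = (lattice_module (scaled (weight t) ` I), encode ` scaled (weight t) ` I)" for t
  have F_iso: "t = t'"
    if "t \<in> thresholds" "t' \<in> thresholds" "zplus_isomorphic R (fst (F t)) (snd (F t)) (fst (F t')) (snd (F t'))" for t t'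
    using that weight_modules_isomorphic_imp_eq by (simp add: F_def)
  have refl: "zplus_isomorphic R (fst (F t)) (snd (F t)) (fst (F t)) (snd (F t))" for t
  proof -
    have "(\<lambda>x. x) \<in> module_homs R (fst (F t)) (fst (F t))" by (simp add: module_homs_def)
    moreover have "bij_betw (\<lambda>x. x) (snd (F t)) (snd (F t))" by (simp add: bij_betw_def)
    ultimately show ?thesis unfolding zplus_isomorphic_def by blast
  qed
  have inj: "inj_on F thresholds"
  proof (rule inj_onI)
    fix t t' assume "t \<in> thresholds" "t' \<in> thresholds" "F t = F t'"
    then show "t = t'" using F_iso[of t t'] refl[of t] by simp
  qed
  show ?thesis
  proof (intro exI[of _ "F ` thresholds"] conjI)
    show "finite (F ` thresholds)" using finite_thresholds by simp
    show "card (F ` thresholds) = (\<Prod>j=1..r. N j ^ (card (prime_factors (d j)) - 1))"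
      by (simp only: card_image[OF inj] card_thresholds)
    show "\<forall>(M, B)\<in>F ` thresholds. irreducible_zplus_module R (root_basis r d N) M B"
      using irreducible_lattice_module[OF cocycle_weight] by (auto simp: F_def)
    show "\<forall>(M, B)\<in>F ` thresholds. \<forall>(M', B')\<in>F ` thresholds.
        zplus_isomorphic R M B M' B' \<longrightarrow> (M, B) = (M', B')"
    proof (intro ballI, clarify)
      fix M B M' B' t t'
      assume "t \<in> thresholds" "t' \<in> thresholds" "(M, B) = F t" "(M', B') = F t'" "zplus_isomorphic R M B M' B'"
      then have "t = t'" by (intro F_iso) (auto simp: prod_eq_iff)
      then show "M = M' \<and> B = B'" using \<open>(M, B) = F t\<close> \<open>(M', B') = F t'\<close> by (metis prod.inject)
    qed
    show "\<forall>(M :: (real, 'm) module) B. irreducible_zplus_module R (root_basis r d N) M B \<longrightarrow>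
        (\<exists>(M', B')\<in>F ` thresholds. zplus_isomorphic R M B M' B')"
    proof (intro allI impI)
      fix M :: "(real, 'm) module" and B
      assume irr: "irreducible_zplus_module R (root_basis r d N) M B"
      then interpret zplus_module R "root_basis r d N" M B by (simp add: irreducible_zplus_module_def)
      interpret root_module r d N M B ..
      obtain t where "t \<in> thresholds" "zplus_isomorphic R M B (fst (F t)) (snd (F t))"
        using irreducible_isomorphic_to_weight_module[OF irr] by (auto simp: F_def)
      then show "\<exists>(M', B')\<in>F ` thresholds. zplus_isomorphic R M B M' B'"
        by (intro bexI[of _ "F t"]) (auto simp: split_def)
    qed
  qed
qed

end
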